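(* Let $0<q<1$. (a) If $\alpha>0$ and $x,y$ are real numbers with $0<x<1$ and $0<y<1$, then the function $$\sum_{n=0}^{\infty}\frac{h_{n}(x,y|q)}{(q;q)_{n}}q^{\alpha n^2}z^n$$ of the complex variable $z$ has infinitely many real zeros, and all of them are negative. (b) If $\alpha\geq \frac12$ and $x,y$ are real numbers with $-1<x<0$ and $-1<y<0$, then the function $$\sum_{n=0}^{\infty}\frac{g_{n}(x,y|q)}{(q;q)_{n}}q^{\alpha n^2}z^n$$ of the complex variable $z$ has infinitely many real zeros, and all of them are positive.
   Context: For $0<q<1$: $(a;q)_0=1$, $(a;q)_k=\prod_{j=0}^{k-1}(1-aq^j)$ for $k\geq 1$. The Gaussian binomial coefficient is $\left[{n\atop k}\right]_q=\frac{(q;q)_n}{(q;q)_k(q;q)_{n-k}}$ for $0\le k\le n$. The Rogers-Szegő polynomials are $h_n(x,y|q)=\sum_{k=0}^n\left[{n\atop k}\right]_q x^k y^{n-k}$, and the Stieltjes-Wigert polynomials are $g_n(x,y|q)=\sum_{k=0}^n\left[{n\atop k}\right]_q q^{k(k-n)}x^k y^{n-k}$. *)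

theory Defs
  imports Complex_Main
begin

definition qpoch :: "real \<Rightarrow> real \<Rightarrow> nat \<Rightarrow> real" where
  "qpoch a q k = (\<Prod>j<k. 1 - a * q ^ j)"

text \<open>Only meaningful for \<open>k \<le> n\<close>: the subtraction \<open>n - k\<close> truncates otherwise.\<close>

definition gauss_binom :: "real \<Rightarrow> nat \<Rightarrow> nat \<Rightarrow> real" where
  "gauss_binom q n k = qpoch q q n / (qpoch q q k * qpoch q q (n - k))"

definition rogers_szego :: "nat \<Rightarrow> real \<Rightarrow> real \<Rightarrow> real \<Rightarrow> real" where
  "rogers_szego n x y q = (\<Sum>k\<le>n. gauss_binom q n k * x ^ k * y ^ (n - k))"

text \<open>The exponent \<open>k (k - n)\<close> of \<open>q\<close> is a nonpositive integer, hence the integer power.\<close>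

definition stieltjes_wigert :: "nat \<Rightarrow> real \<Rightarrow> real \<Rightarrow> real \<Rightarrow> real" where
  "stieltjes_wigert n x y q =
     (\<Sum>k\<le>n. gauss_binom q n k * q powi (int k * (int k - int n)) * x ^ k * y ^ (n - k))"

definition rogers_szego_series :: "real \<Rightarrow> real \<Rightarrow> real \<Rightarrow> real \<Rightarrow> complex \<Rightarrow> complex" where
  "rogers_szego_series \<alpha> x y q z =
     (\<Sum>n. complex_of_real (rogers_szego n x y q / qpoch q q n * q powr (\<alpha> * (real n)\<^sup>2)) * z ^ n)"

definition stieltjes_wigert_series :: "real \<Rightarrow> real \<Rightarrow> real \<Rightarrow> real \<Rightarrow> complex \<Rightarrow> complex" where
  "stieltjes_wigert_series \<alpha> x y q z =
     (\<Sum>n. complex_of_real (stieltjes_wigert n x y q / qpoch q q n * q powr (\<alpha> * (real n)\<^sup>2)) * z ^ n)"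

end

theory Submission
  imports Defs "HOL-Analysis.Analysis"
begin

text \<open>
  The coefficients are positive, so only the existence of infinitely many negative zeros is at issue
  (in part (b) after replacing \<open>z\<close> by \<open>- z\<close>). Put the series in the form
  \<open>f(t) = \<Sum> e\<^sub>n p\<^bsup>n\<^sup>2\<^esup> t\<^sup>n\<close>.
  At \<open>t = - p\<^bsup>- 2 m\<^esup>\<close> completing the square centres the sum at \<open>n = m\<close>.
  If \<open>e\<^sub>n\<close> is asymptotic to \<open>A + (- 1)\<^sup>n B\<close>, then up to a positive factor
  \<open>(- 1)\<^sup>m f(t)\<close> tends to \<open>A \<theta>(p, - 1) \<plusminus> B \<theta>(p, 1)\<close> with
  \<open>\<theta>(p, u) = \<Sum> p\<^bsup>k\<^sup>2\<^esup> u\<^sup>k\<close> summed over all integers \<open>k\<close>.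
  So \<open>f\<close> changes sign infinitely often as soon as \<open>\<bar>B\<bar> \<theta>(p, 1) < A \<theta>(p, - 1)\<close>.

  For the Rogers-Szego series the quotients of consecutive coefficients converge, so after scaling
  \<open>A = 1\<close>, \<open>B = 0\<close>, and positivity of \<open>\<theta>(p, - 1)\<close> follows from Jacobi's triple product.
  For the Stieltjes-Wigert series take \<open>p = q\<^bsup>\<alpha> - 1/4\<^esup>\<close>,
  \<open>s = q\<^bsup>1/4\<^esup>\<close>; then \<open>A\<close> and \<open>B\<close> are proportional to
  \<open>\<theta>(s, u)\<close> and \<open>\<theta>(s, - u)\<close> with \<open>u = sqrt (x / y)\<close>, and for
  \<open>\<alpha> > 1/2\<close>, that is \<open>p < s\<close>, the inequality again follows from the triple product.
  For \<open>\<alpha> = 1/2\<close> the series factors into two series of the first kind.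
\<close>

section \<open>Theta series\<close>

text \<open>Tannery's theorem: \<open>M\<close> makes the finite partial sums converge uniformly in
  \<open>n\<close>, so the limit in \<open>n\<close> and the limit over finite index sets may be
  exchanged.\<close>

lemma infsum_tendsto_dominated:
  fixes f :: "nat \<Rightarrow> 'a \<Rightarrow> real"
  assumes lim: "\<And>k. (\<lambda>n. f n k) \<longlonglongrightarrow> g k"
    and bound: "\<And>n k. \<bar>f n k\<bar> \<le> M k"
    and M: "M summable_on UNIV"
  shows "(\<lambda>n. \<Sum>\<^sub>\<infinity>k. f n k) \<longlonglongrightarrow> (\<Sum>\<^sub>\<infinity>k. g k)"
proof -
  have g_bound: "\<bar>g k\<bar> \<le> M k" for k
    by (rule tendsto_upperbound[OF tendsto_rabs[OF lim]]) (use bound in auto)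
  have "(\<lambda>k. norm (g k)) summable_on UNIV"
    by (rule summable_on_comparison_test[OF M]) (use g_bound in auto)
  then have g: "g summable_on UNIV"
    by (rule abs_summable_summable)
  have "uniform_limit UNIV (\<lambda>X n. \<Sum>k\<in>X. f n k) (\<lambda>n. \<Sum>\<^sub>\<infinity>k. f n k) (finite_subsets_at_top UNIV)"
    by (rule Weierstrass_m_test_general[OF _ M]) (use bound in auto)
  then show ?thesis
    by (rule swap_uniform_limit'[rotated 2])
       (use g in \<open>auto intro!: tendsto_sum lim always_eventually simp: infsum_tendsto\<close>)
qed

lemma filterlim_nat_int_add: "filterlim (\<lambda>n. nat (int n + k)) at_top sequentially"
  unfolding filterlim_at_top
proof
  fix Z
  show "\<forall>\<^sub>F n in sequentially. Z \<le> nat (int n + k)"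
    using eventually_ge_at_top[of "Z + nat \<bar>k\<bar>"] by eventually_elim linarith
qed

lemma summable_on_int:
  fixes f :: "int \<Rightarrow> real"
  assumes "summable (\<lambda>n. norm (f (int n)))" and "summable (\<lambda>n. norm (f (- int n)))"
  shows "f summable_on UNIV"
proof -
  have "(\<lambda>n. f (int n)) summable_on UNIV" "(\<lambda>n. f (- int n)) summable_on UNIV"
    using assms by (auto intro: norm_summable_imp_summable_on)
  then have "f summable_on range int" "f summable_on range (\<lambda>n. - int n)"
    by (auto simp: summable_on_reindex inj_on_def o_def)
  then have "f summable_on (range int \<union> range (\<lambda>n. - int n))"
    by (rule summable_on_union)
  also have "range int \<union> range (\<lambda>n. - int n) = UNIV"
    by (auto simp: image_iff) (metis int_cases2)
  finally show ?thesis .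
qed

text \<open>In absolute value the \<open>n\<close>-th term is \<open>(s ^ n * |v|) ^ n\<close>,
  whose base tends to 0, so a geometric series dominates whatever \<open>v\<close> is.\<close>

lemma summable_gaussian:
  fixes s v :: real
  assumes "0 < s" "s < 1"
  shows "summable (\<lambda>n. s powr (real n)\<^sup>2 * v ^ n)"
proof (rule summable_comparison_test_ev)
  have "(\<lambda>n. s ^ n * \<bar>v\<bar>) \<longlonglongrightarrow> 0 * \<bar>v\<bar>"
    using assms by (intro tendsto_intros) auto
  then have "\<forall>\<^sub>F n in sequentially. s ^ n * \<bar>v\<bar> < 1 / 2"
    by (rule order_tendstoD) auto
  then show "\<forall>\<^sub>F n in sequentially. norm (s powr (real n)\<^sup>2 * v ^ n) \<le> (1 / 2) ^ n"
  proof eventually_elim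
    case (elim n)
    have "s powr (real n)\<^sup>2 = (s ^ n) ^ n"
      using assms by (simp add: powr_realpow power2_eq_square flip: of_nat_mult power_mult)
    then have "norm (s powr (real n)\<^sup>2 * v ^ n) = (s ^ n * \<bar>v\<bar>) ^ n"
      using assms by (simp add: abs_mult power_mult_distrib power_abs)
    also have "\<dots> \<le> (1 / 2) ^ n"
      using elim assms by (intro power_mono) auto
    finally show ?case .
  qed
qed (simp add: summable_geometric)

text \<open>Jacobi's theta function with nome \<open>s\<close>, as a bilateral series. Negative
  \<open>u\<close> occur below, hence the integer power of \<open>u\<close> rather than
  \<open>powr\<close>.\<close>

definition theta :: "real \<Rightarrow> real \<Rightarrow> real" where
  "theta s u = (\<Sum>\<^sub>\<infinity>k. s powr (real_of_int k)\<^sup>2 * u powi k)"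

lemma theta_summable:
  fixes s u :: real
  assumes "0 < s" "s < 1"
  shows "(\<lambda>k. s powr (real_of_int k)\<^sup>2 * u powi k) summable_on UNIV"
proof (rule summable_on_int)
  show "summable (\<lambda>n. norm (s powr (real_of_int (int n))\<^sup>2 * u powi int n))"
    using summable_gaussian[OF assms, of "\<bar>u\<bar>"] by (simp add: abs_mult power_abs)
  show "summable (\<lambda>n. norm (s powr (real_of_int (- int n))\<^sup>2 * u powi (- int n)))"
    using summable_gaussian[OF assms, of "\<bar>inverse u\<bar>"]
    by (simp add: abs_mult power_abs power_int_minus power_inverse)
qed

section \<open>q-shifted factorials and Gaussian binomials\<close>

lemma qpoch_0 [simp]: "qpoch a q 0 = 1"
  by (simp add: qpoch_def)

lemma qpoch_Suc: "qpoch a q (Suc k) = qpoch a q k * (1 - a * q ^ k)"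
  by (simp add: qpoch_def)

lemma qpoch_self_pos:
  assumes "0 < q" "q < 1"
  shows "qpoch q q k > 0"
  unfolding qpoch_def
  by (intro prod_pos) (use assms power_Suc_less_one[of q] in auto)

lemma qpoch_self_le_1:
  assumes "0 < q" "q < 1"
  shows "qpoch q q k \<le> 1"
  unfolding qpoch_def
  by (intro prod_le_1) (use assms power_Suc_less_one[of q] in \<open>auto simp: less_imp_le\<close>)

text \<open>The infinite product converges to a positive value because the geometric series does,
  and the partial products decrease towards it. The resulting uniform lower bound supplies the
  majorants in later limit arguments.\<close>

lemma qpoch_self_limit:
  assumes "0 < q" "q < 1"
  obtains L where "L > 0" "qpoch q q \<longlonglongrightarrow> L" "\<And>k. L \<le> qpoch q q k"
proof -
  have lt: "q * q ^ k < 1" for k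
    using assms power_Suc_less_one[of q] by auto
  have dec: "decseq (qpoch q q)"
    using assms qpoch_self_pos[OF assms]
    by (intro decseq_SucI) (auto simp: qpoch_Suc algebra_simps less_imp_le)
  have "abs_convergent_prod (\<lambda>k. 1 - q * q ^ k)"
    by (rule summable_imp_abs_convergent_prod)
       (use assms in \<open>auto simp: abs_mult power_abs intro!: summable_mult summable_geometric\<close>)
  then have "convergent_prod (\<lambda>k. 1 - q * q ^ k)"
    by (rule abs_convergent_prod_imp_convergent_prod)
  then have conv: "(\<lambda>n. \<Prod>k\<le>n. 1 - q * q ^ k) \<longlonglongrightarrow> (\<Prod>k. 1 - q * q ^ k)"
    and pos: "(\<Prod>k. 1 - q * q ^ k) > 0"
    using convergent_prod_LIMSEQ less_0_prodinf[of "\<lambda>k. 1 - q * q ^ k"] lt by auto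
  define L where "L = (\<Prod>k. 1 - q * q ^ k)"
  have "(\<lambda>n. qpoch q q (Suc n)) \<longlonglongrightarrow> L"
    using conv by (simp add: qpoch_def lessThan_Suc_atMost L_def)
  then have lim: "qpoch q q \<longlonglongrightarrow> L"
    by (rule LIMSEQ_imp_Suc)
  have le: "L \<le> qpoch q q k" for k
    by (rule decseq_ge[OF dec lim])
  have "L > 0"
    using pos by (simp add: L_def)
  with lim le that show ?thesis by blast
qed

lemma gauss_binom_0:
  assumes "0 < q" "q < 1"
  shows "gauss_binom q n 0 = 1"
  using qpoch_self_pos[OF assms, of n] by (simp add: gauss_binom_def)

lemma gauss_binom_self:
  assumes "0 < q" "q < 1"
  shows "gauss_binom q n n = 1"
  using qpoch_self_pos[OF assms, of n] by (simp add: gauss_binom_def)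

text \<open>After clearing denominators this is the splitting \<open>1 - q ^ (n + 1) = (1 - q ^ (n -
  k)) + q ^ (n - k) * (1 - q ^ (k + 1))\<close>.\<close>

lemma gauss_binom_pascal:
  assumes "0 < q" "q < 1" and "k < n"
  shows "gauss_binom q (Suc n) (Suc k) = gauss_binom q n (Suc k) + q ^ (n - k) * gauss_binom q n k"
proof -
  obtain d where n: "n = Suc (k + d)"
    using \<open>k < n\<close> less_iff_Suc_add by auto
  have pos: "qpoch q q j \<noteq> 0" for j
    using qpoch_self_pos[OF assms(1,2), of j] by simp
  have ne: "1 - q * q ^ j \<noteq> 0" for j
    using assms power_Suc_less_one[of q j] by auto
  define a b where "a = 1 - q * q ^ k" and "b = 1 - q * q ^ d"
  have ab: "a \<noteq> 0" "b \<noteq> 0" "1 - q * q ^ n = b + q ^ (n - k) * a"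
    using ne by (auto simp: a_def b_def n power_add algebra_simps)
  have "gauss_binom q (Suc n) (Suc k) = qpoch q q n * (b + q ^ (n - k) * a) / (qpoch q q k * a * (qpoch q q d * b))"
    unfolding gauss_binom_def qpoch_Suc[of _ _ n] ab(3) by (simp add: n qpoch_Suc a_def b_def)
  also have "\<dots> = qpoch q q n / (qpoch q q k * a * qpoch q q d) +
      q ^ (n - k) * (qpoch q q n / (qpoch q q k * (qpoch q q d * b)))"
    using ab(1,2) pos[of k] pos[of d] by (simp add: field_simps)
  also have "\<dots> = gauss_binom q n (Suc k) + q ^ (n - k) * gauss_binom q n k"
    by (simp add: gauss_binom_def n qpoch_Suc a_def b_def)
  finally show ?thesis .
qed

text \<open>The q-binomial theorem in base \<open>s\<^sup>2\<close>: with \<open>s\<close> at hand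
  the usual exponent \<open>k (k - 1) / 2\<close> combines with the odd shift to a perfect square.
  In the induction, multiplying by the new factor matches coefficients through the q-Pascal
  rule.\<close>

lemma gauss_binomial_theorem:
  fixes s z :: real
  assumes "0 < s" "s < 1"
  shows "(\<Prod>i<n. 1 + s ^ (2 * i + 1) * z) = (\<Sum>k\<le>n. gauss_binom (s\<^sup>2) n k * s ^ k\<^sup>2 * z ^ k)"
proof (induction n)
  case 0
  show ?case by (simp add: gauss_binom_def)
next
  case (Suc n)
  define c where "c n k = gauss_binom (s\<^sup>2) n k * s ^ k\<^sup>2 * z ^ k" for n k
  have q: "0 < s\<^sup>2" "s\<^sup>2 < 1"
    using assms by (auto simp: power_less_one_iff)
  have step: "c (Suc n) (Suc k) = c n (Suc k) + s ^ (2 * n + 1) * z * c n k" if k: "k < n" for k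
  proof -
    have "s ^ (2 * n + 1) * s ^ k\<^sup>2 = (s\<^sup>2) ^ (n - k) * s ^ (Suc k)\<^sup>2"
    proof -
      have "2 * n + 1 + k\<^sup>2 = 2 * (n - k) + (Suc k)\<^sup>2"
        using k by (simp add: power2_eq_square algebra_simps)
      then show ?thesis
        by (simp only: flip: power_mult power_add)
    qed
    then show ?thesis
      by (simp add: c_def gauss_binom_pascal[OF q k] algebra_simps)
  qed
  \<comment> \<open>The top coefficient is treated apart, since truncated subtraction makes
    \<open>gauss_binom q n (Suc n)\<close> nonzero and the Pascal rule fails at
    \<open>k = n\<close>.\<close>
  have last: "c (Suc n) (Suc n) = s ^ (2 * n + 1) * z * c n n"
  proof -
    have "(Suc n)\<^sup>2 = 2 * n + 1 + n\<^sup>2"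
      by (simp add: power2_eq_square)
    then show ?thesis
      unfolding c_def gauss_binom_self[OF q] by (simp add: power_add)
  qed
  have "(\<Sum>k\<le>Suc n. c (Suc n) k) = c (Suc n) 0 + (\<Sum>k\<le>n. c (Suc n) (Suc k))"
    by (rule sum.atMost_Suc_shift)
  also have "(\<Sum>k\<le>n. c (Suc n) (Suc k)) = (\<Sum>k<n. c (Suc n) (Suc k)) + c (Suc n) (Suc n)"
    by (simp flip: lessThan_Suc_atMost)
  also have "(\<Sum>k<n. c (Suc n) (Suc k)) = (\<Sum>k<n. c n (Suc k)) + s ^ (2 * n + 1) * z * (\<Sum>k<n. c n k)"
    by (simp add: step sum.distrib sum_distrib_left)
  also have "c (Suc n) 0 = c n 0"
    by (simp add: c_def gauss_binom_0[OF q])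
  also have "c n 0 + ((\<Sum>k<n. c n (Suc k)) + s ^ (2 * n + 1) * z * (\<Sum>k<n. c n k) + c (Suc n) (Suc n))
      = (c n 0 + (\<Sum>k<n. c n (Suc k))) + s ^ (2 * n + 1) * z * ((\<Sum>k<n. c n k) + c n n)"
    by (simp add: last algebra_simps)
  also have "c n 0 + (\<Sum>k<n. c n (Suc k)) = (\<Sum>k\<le>n. c n k)"
    by (simp add: sum.atMost_shift)
  also have "(\<Sum>k<n. c n k) + c n n = (\<Sum>k\<le>n. c n k)"
    by (simp flip: lessThan_Suc_atMost)
  finally have "(\<Sum>k\<le>Suc n. c (Suc n) k) = (1 + s ^ (2 * n + 1) * z) * (\<Sum>k\<le>n. c n k)"
    by (simp add: algebra_simps)
  then show ?case
    using Suc.IH by (simp add: c_def mult.commute)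
qed

section \<open>Jacobi's triple product, in finite form and in the limit\<close>

text \<open>Take \<open>2 * N\<close> factors of the q-binomial theorem at
  \<open>z = u / s ^ (2 * N)\<close>. The upper half gives the factors with \<open>u\<close>. The
  lower half, reversed and multiplied by \<open>s ^ (2 * i + 1) / u\<close> factor by factor, gives
  those with \<open>1 / u\<close>; the odd numbers sum to \<open>N\<^sup>2\<close>, which completes
  the square in the exponent.\<close>

lemma finite_jacobi_triple_product:
  fixes s u :: real
  assumes "0 < s" "s < 1" "u \<noteq> 0"
  shows "(\<Prod>i<N. (1 + s ^ (2 * i + 1) * u) * (1 + s ^ (2 * i + 1) / u)) =
    (\<Sum>k\<le>2 * N. gauss_binom (s\<^sup>2) (2 * N) k *
      (s powr (real_of_int (int k - int N))\<^sup>2 * u powi (int k - int N)))"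
proof -
  define z where "z = u / s ^ (2 * N)"
  have split: "(\<Prod>i<M + N. f i) = (\<Prod>i<M. f i) * (\<Prod>i<N. f (M + i))" for f :: "nat \<Rightarrow> real" and M
    by (induction N) (auto simp: algebra_simps)
  have scale: "(\<Prod>i<N. s ^ (2 * i + 1) / u) = s ^ N\<^sup>2 / u ^ N"
  proof (induction N)
    case (Suc N)
    have "(Suc N)\<^sup>2 = N\<^sup>2 + (2 * N + 1)"
      by (simp add: power2_eq_square)
    then show ?case
      unfolding prod.lessThan_Suc Suc by (simp add: power_add mult.commute mult.left_commute)
  qed simp
  have low: "s ^ (2 * i + 1) / u * (1 + s ^ (2 * (N - Suc i) + 1) * z) = 1 + s ^ (2 * i + 1) / u"
    if "i < N" for i
  proof -
    have "s ^ (2 * i + 1) * s ^ (2 * (N - Suc i) + 1) = s ^ (2 * N)"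
    proof -
      have "2 * i + 1 + (2 * (N - Suc i) + 1) = 2 * N"
        using that by simp
      then show ?thesis
        by (simp only: flip: power_add)
    qed
    then show ?thesis
      using assms by (simp add: z_def field_simps)
  qed
  have high: "1 + s ^ (2 * (N + i) + 1) * z = 1 + s ^ (2 * i + 1) * u" for i
    using assms by (simp add: z_def power_add algebra_simps)
  have "s ^ N\<^sup>2 / u ^ N * (\<Prod>i<2 * N. 1 + s ^ (2 * i + 1) * z) =
     (\<Prod>i<N. s ^ (2 * i + 1) / u) * (\<Prod>i<N. 1 + s ^ (2 * (N - Suc i) + 1) * z) *
     (\<Prod>i<N. 1 + s ^ (2 * (N + i) + 1) * z)"
    using prod.nat_diff_reindex[of "\<lambda>i. 1 + s ^ (2 * i + 1) * z" N] split[of "\<lambda>i. 1 + s ^ (2 * i + 1) * z" N]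
    by (simp only: scale mult_2[symmetric] mult.assoc)
  also have "\<dots> = (\<Prod>i<N. s ^ (2 * i + 1) / u * (1 + s ^ (2 * (N - Suc i) + 1) * z)) *
     (\<Prod>i<N. 1 + s ^ (2 * i + 1) * u)"
    by (simp only: high prod.distrib)
  also have "\<dots> = (\<Prod>i<N. (1 + s ^ (2 * i + 1) * u) * (1 + s ^ (2 * i + 1) / u))"
    using low by (simp add: prod.distrib mult.commute)
  finally have "(\<Prod>i<N. (1 + s ^ (2 * i + 1) * u) * (1 + s ^ (2 * i + 1) / u)) =
     s ^ N\<^sup>2 / u ^ N * (\<Sum>k\<le>2 * N. gauss_binom (s\<^sup>2) (2 * N) k * s ^ k\<^sup>2 * z ^ k)"
    by (simp only: gauss_binomial_theorem[OF assms(1,2)])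
  also have "\<dots> = (\<Sum>k\<le>2 * N. gauss_binom (s\<^sup>2) (2 * N) k *
      (s powr (real_of_int (int k - int N))\<^sup>2 * u powi (int k - int N)))"
    unfolding sum_distrib_left
  proof (rule sum.cong)
    fix k
    have "(real_of_int (int k - int N))\<^sup>2 = real (N\<^sup>2) + real (k\<^sup>2) - real (2 * N * k)"
      by (simp add: power2_eq_square algebra_simps)
    then have "s powr (real_of_int (int k - int N))\<^sup>2 = s ^ N\<^sup>2 * s ^ k\<^sup>2 / (s ^ (2 * N)) ^ k"
      using assms by (simp only: powr_add powr_diff powr_realpow power_mult)
    moreover have "u powi (int k - int N) = u ^ k / u ^ N"
      using assms by (simp add: power_int_diff)
    ultimately show "s ^ N\<^sup>2 / u ^ N * (gauss_binom (s\<^sup>2) (2 * N) k * s ^ k\<^sup>2 * z ^ k) =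
      gauss_binom (s\<^sup>2) (2 * N) k *
        (s powr (real_of_int (int k - int N))\<^sup>2 * u powi (int k - int N))"
      by (simp add: z_def power_divide mult_ac)
  qed simp
  finally show ?thesis .
qed

text \<open>The normalisation turns the Gaussian binomials into weights that tend to 1, so that the
  partial products of Jacobi's triple product converge to theta up to a positive factor.\<close>

lemma theta_limit:
  fixes s u :: real
  assumes "0 < s" "s < 1" "u \<noteq> 0"
  shows "(\<lambda>N. (qpoch (s\<^sup>2) (s\<^sup>2) N)\<^sup>2 / qpoch (s\<^sup>2) (s\<^sup>2) (2 * N) *
     (\<Prod>i<N. (1 + s ^ (2 * i + 1) * u) * (1 + s ^ (2 * i + 1) / u))) \<longlonglongrightarrow> theta s u"
proof -
  have q: "0 < s\<^sup>2" "s\<^sup>2 < 1"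
    using assms by (auto simp: power_less_one_iff)
  define P where "P = qpoch (s\<^sup>2) (s\<^sup>2)"
  obtain L where L: "L > 0" "P \<longlonglongrightarrow> L" "\<And>k. L \<le> P k"
    using qpoch_self_limit[OF q] unfolding P_def by blast
  have P: "P k > 0" "P k \<le> 1" for k
    unfolding P_def using qpoch_self_pos[OF q] qpoch_self_le_1[OF q] by auto
  define t where "t k = s powr (real_of_int k)\<^sup>2 * u powi k" for k
  \<comment> \<open>The normalised Gaussian binomial with upper index \<open>2 * N\<close> and lower
    index \<open>N + k\<close>, extended by zero so that the sums for all \<open>N\<close> range
    over the same index set.\<close>
  define w where "w N k = (if \<bar>k\<bar> \<le> int N then (P N)\<^sup>2 / (P (nat (int N + k)) * P (nat (int N - k))) else 0)"
    for N k
  have "(P N)\<^sup>2 / P (2 * N) * (\<Prod>i<N. (1 + s ^ (2 * i + 1) * u) * (1 + s ^ (2 * i + 1) / u)) =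
    (\<Sum>\<^sub>\<infinity>k. w N k * t k)" for N
  proof -
    have "(\<Sum>\<^sub>\<infinity>k. w N k * t k) = (\<Sum>\<^sub>\<infinity>k\<in>{- int N..int N}. w N k * t k)"
      by (rule infsum_cong_neutral) (auto simp: w_def)
    also have "\<dots> = (\<Sum>k=- int N..int N. w N k * t k)"
      by simp
    also have "\<dots> = (\<Sum>k\<le>2 * N. w N (int k - int N) * t (int k - int N))"
      by (rule sum.reindex_bij_witness[of _ "\<lambda>k. int k - int N" "\<lambda>k. nat (k + int N)"]) auto
    also have "\<dots> = (\<Sum>k\<le>2 * N. (P N)\<^sup>2 / P (2 * N) * (gauss_binom (s\<^sup>2) (2 * N) k * t (int k - int N)))"
    proof (rule sum.cong)
      fix k assume "k \<in> {..2 * N}"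
      then have "w N (int k - int N) = (P N)\<^sup>2 / (P k * P (2 * N - k))"
        by (auto simp: w_def nat_diff_distrib' intro!: arg_cong2[where f = "(*)"] arg_cong[where f = P])
      then show "w N (int k - int N) * t (int k - int N) =
          (P N)\<^sup>2 / P (2 * N) * (gauss_binom (s\<^sup>2) (2 * N) k * t (int k - int N))"
        using P(1)[of "2 * N"] by (simp add: gauss_binom_def P_def)
    qed simp
    finally show ?thesis
      unfolding finite_jacobi_triple_product[OF assms] by (simp add: sum_distrib_left t_def)
  qed
  moreover have "(\<lambda>N. \<Sum>\<^sub>\<infinity>k. w N k * t k) \<longlonglongrightarrow> (\<Sum>\<^sub>\<infinity>k. t k)"
  proof (rule infsum_tendsto_dominated)
    show "(\<lambda>k. 1 / L\<^sup>2 * \<bar>t k\<bar>) summable_on UNIV"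
      using theta_summable[OF assms(1,2), of u, THEN summable_on_iff_abs_summable_on_real[THEN iffD1]]
      by (intro summable_on_cmult_right) (simp add: t_def)
    show "\<bar>w N k * t k\<bar> \<le> 1 / L\<^sup>2 * \<bar>t k\<bar>" for N k
    proof -
      have "(P N)\<^sup>2 / (P i * P j) \<le> 1 / L\<^sup>2" for i j
        using L P unfolding power2_eq_square
        by (intro frac_le mult_mono mult_le_one mult_pos_pos) (auto simp: less_imp_le)
      then have "\<bar>w N k\<bar> \<le> 1 / L\<^sup>2"
        using P(1) by (auto simp: w_def abs_mult abs_of_pos)
      then show ?thesis
        unfolding abs_mult by (intro mult_right_mono) auto
    qed
    show "(\<lambda>N. w N k * t k) \<longlonglongrightarrow> t k" for k
    proof -
      have "filterlim (\<lambda>N. nat (int N + k)) at_top sequentially"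
        "filterlim (\<lambda>N. nat (int N - k)) at_top sequentially"
        using filterlim_nat_int_add[of k] filterlim_nat_int_add[of "- k"] by simp_all
      then have "(\<lambda>N. (P N)\<^sup>2 / (P (nat (int N + k)) * P (nat (int N - k)))) \<longlonglongrightarrow> L\<^sup>2 / (L * L)"
        using L by (intro tendsto_intros) (auto intro: filterlim_compose)
      also have "L\<^sup>2 / (L * L) = 1"
        using L by (simp add: power2_eq_square)
      finally have "(\<lambda>N. w N k) \<longlonglongrightarrow> 1"
      proof (rule Lim_transform_eventually)
        show "\<forall>\<^sub>F N in sequentially. (P N)\<^sup>2 / (P (nat (int N + k)) * P (nat (int N - k))) = w N k"
          using eventually_ge_at_top[of "nat \<bar>k\<bar>"] by eventually_elim (auto simp: w_def)
      qed
      then show ?thesis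
        by (auto intro: tendsto_eq_intros)
    qed
  qed
  ultimately show ?thesis
    by (simp add: theta_def t_def P_def)
qed

section \<open>Positivity and comparison of theta values\<close>

lemma theta_pos:
  assumes "0 < s" "s < 1" "u > 0"
  shows "theta s u > 0"
proof -
  have "0 < (\<Sum>k\<in>{0}. s powr (real_of_int k)\<^sup>2 * u powi k)"
    using assms by simp
  also have "\<dots> \<le> theta s u"
    unfolding theta_def
    by (rule finite_sum_le_infsum[OF theta_summable]) (use assms in auto)
  finally show ?thesis .
qed

text \<open>At \<open>u = - 1\<close> the triple product is the square of the product of all
  \<open>1 - s ^ (2 * i + 1)\<close>. Inserting the even exponents as well only makes that product
  smaller, so \<open>qpoch s s\<close> bounds it away from 0 and the limit stays strictly
  positive.\<close>

lemma theta_minus_one_pos: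
  assumes "0 < s" "s < 1"
  shows "theta s (- 1) > 0"
proof -
  have q: "0 < s\<^sup>2" "s\<^sup>2 < 1"
    using assms by (auto simp: power_less_one_iff)
  obtain L where L: "L > 0" "\<And>k. L \<le> qpoch (s\<^sup>2) (s\<^sup>2) k"
    using qpoch_self_limit[OF q] by blast
  obtain K where K: "K > 0" "\<And>k. K \<le> qpoch s s k"
    using qpoch_self_limit[OF assms] by blast
  have lt: "s ^ Suc k < 1" for k
    using assms power_Suc_less_one by blast
  have prod: "qpoch s s (2 * N) \<le> (\<Prod>i<N. 1 - s ^ (2 * i + 1))" for N
  proof (induction N)
    case (Suc N)
    have "qpoch s s (2 * Suc N) = qpoch s s (2 * N) * (1 - s ^ (2 * N + 1)) * (1 - s ^ (2 * N + 2))"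
      by (simp add: qpoch_Suc)
    also have "\<dots> \<le> qpoch s s (2 * N) * (1 - s ^ (2 * N + 1)) * 1"
      using qpoch_self_pos[OF assms, of "2 * N"] lt[of "2 * N"] assms
      by (intro mult_left_mono mult_nonneg_nonneg) auto
    also have "\<dots> \<le> (\<Prod>i<N. 1 - s ^ (2 * i + 1)) * (1 - s ^ (2 * N + 1))"
      using Suc lt[of "2 * N"] by (auto intro!: mult_right_mono)
    finally show ?case by simp
  qed simp
  have "L\<^sup>2 * K\<^sup>2 \<le> (qpoch (s\<^sup>2) (s\<^sup>2) N)\<^sup>2 / qpoch (s\<^sup>2) (s\<^sup>2) (2 * N) *
     (\<Prod>i<N. (1 + s ^ (2 * i + 1) * - 1) * (1 + s ^ (2 * i + 1) / - 1))" for N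
  proof (rule mult_mono)
    have "L\<^sup>2 \<le> (qpoch (s\<^sup>2) (s\<^sup>2) N)\<^sup>2"
      using L by (intro power_mono) auto
    also have "\<dots> \<le> (qpoch (s\<^sup>2) (s\<^sup>2) N)\<^sup>2 / qpoch (s\<^sup>2) (s\<^sup>2) (2 * N)"
      using qpoch_self_pos[OF q, of "2 * N"] qpoch_self_le_1[OF q, of "2 * N"]
      by (simp add: pos_le_divide_eq mult_left_le)
    finally show "L\<^sup>2 \<le> (qpoch (s\<^sup>2) (s\<^sup>2) N)\<^sup>2 / qpoch (s\<^sup>2) (s\<^sup>2) (2 * N)" .
    have "K\<^sup>2 \<le> (\<Prod>i<N. 1 - s ^ (2 * i + 1))\<^sup>2"
      using K order_trans[OF K(2) prod] by (intro power_mono) auto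
    then show "K\<^sup>2 \<le> (\<Prod>i<N. (1 + s ^ (2 * i + 1) * - 1) * (1 + s ^ (2 * i + 1) / - 1))"
      by (simp add: power2_eq_square flip: prod.distrib)
  qed (use qpoch_self_pos[OF q] in \<open>auto simp: less_imp_le\<close>)
  then have "L\<^sup>2 * K\<^sup>2 \<le> theta s (- 1)"
    by (intro tendsto_lowerbound[OF theta_limit[OF assms]] always_eventually) auto
  moreover have "L\<^sup>2 * K\<^sup>2 > 0"
    using L(1) K(1) by simp
  ultimately show ?thesis by linarith
qed

text \<open>With \<open>v = u + 1 / u \<ge> 2\<close> the difference of the two sides is \<open>2 *
  a * (1 + b\<^sup>2) * (v - 2) + 4 * (a - b) * (1 - a * b)\<close>, a nonnegative plus a positive
  term.\<close>

lemma theta_factor_compare: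
  fixes a b u :: real
  assumes "0 < b" "b < a" "a < 1" "u > 0"
  shows "(1 - a * u) * (1 - a / u) * (1 + b)\<^sup>2 < (1 + a * u) * (1 + a / u) * (1 - b)\<^sup>2"
proof -
  define v where "v = u + 1 / u"
  have "0 \<le> (u - 1)\<^sup>2 / u"
    using assms by simp
  also have "\<dots> = v - 2"
    using assms by (simp add: v_def power2_eq_square field_simps)
  finally have v: "v \<ge> 2" by simp
  have "(1 - a * u) * (1 - a / u) = 1 + a\<^sup>2 - a * v" "(1 + a * u) * (1 + a / u) = 1 + a\<^sup>2 + a * v"
    using assms by (simp_all add: v_def power2_eq_square field_simps)
  then have "(1 + a * u) * (1 + a / u) * (1 - b)\<^sup>2 - (1 - a * u) * (1 - a / u) * (1 + b)\<^sup>2 =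
      (1 + a\<^sup>2 + a * v) * (1 - b)\<^sup>2 - (1 + a\<^sup>2 - a * v) * (1 + b)\<^sup>2"
    by (simp only:)
  also have "\<dots> = 2 * a * (1 + b\<^sup>2) * (v - 2) + 4 * (a - b) * (1 - a * b)"
    by (simp add: power2_eq_square algebra_simps)
  finally have "(1 + a * u) * (1 + a / u) * (1 - b)\<^sup>2 - (1 - a * u) * (1 - a / u) * (1 + b)\<^sup>2 = \<dots>" .
  moreover have "a * b < 1"
    using mult_strict_mono[of a 1 b 1] assms by simp
  moreover have "2 * a * (1 + b\<^sup>2) * (v - 2) \<ge> 0"
    using assms v by (intro mult_nonneg_nonneg) auto
  ultimately show ?thesis
    using assms by (smt (verit) mult_pos_pos)
qed

text \<open>For \<open>u\<close> in this range all factors of the triple product at \<open>- u\<close> are nonnegative,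
  so the products can be compared factor by factor.\<close>

lemma theta_compare_fundamental:
  assumes "0 < p" "p < s" "s < 1" "s \<le> u" "u \<le> 1 / s"
  shows "\<bar>theta s (- u)\<bar> * theta p 1 < theta s u * theta p (- 1)"
proof -
  have s: "0 < s" and p: "p < 1" and u: "u > 0"
    using assms by auto
  define G where "G r w N = (\<Prod>i<N. (1 + r ^ (2 * i + 1) * w) * (1 + r ^ (2 * i + 1) / w))"
    for r w :: real and N
  define D where "D r N = (qpoch (r\<^sup>2) (r\<^sup>2) N)\<^sup>2 / qpoch (r\<^sup>2) (r\<^sup>2) (2 * N)"
    for r :: real and N
  have D: "D r N > 0" if "0 < r" "r < 1" for r N
  proof -
    have q: "0 < r\<^sup>2" "r\<^sup>2 < 1"
      using that by (auto simp: power_less_one_iff)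
    show ?thesis
      unfolding D_def by (intro divide_pos_pos zero_less_power qpoch_self_pos[OF q])
  qed
  have lim: "(\<lambda>N. D r N * G r w N) \<longlonglongrightarrow> theta r w" if "0 < r" "r < 1" "w \<noteq> 0" for r w
    using theta_limit[OF that] by (simp add: D_def G_def)
  define l where "l i = (1 - s ^ (2 * i + 1) * u) * (1 - s ^ (2 * i + 1) / u) * (1 + p ^ (2 * i + 1))\<^sup>2" for i
  define r where "r i = (1 + s ^ (2 * i + 1) * u) * (1 + s ^ (2 * i + 1) / u) * (1 - p ^ (2 * i + 1))\<^sup>2" for i
  have pw: "s ^ (2 * i + 1) \<le> s" "s ^ (2 * i + 1) < 1" "p ^ (2 * i + 1) < s ^ (2 * i + 1)" for i
    using assms s power_decreasing[of 1 "2 * i + 1" s] power_Suc_less_one[of s "2 * i"]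
      power_strict_mono[of p s "2 * i + 1"] by simp_all
  have nonneg: "0 \<le> 1 - s ^ (2 * i + 1) * u" "0 \<le> 1 - s ^ (2 * i + 1) / u" for i
  proof -
    have "s ^ (2 * i + 1) * u \<le> s * u"
      using pw(1) u by (intro mult_right_mono) auto
    also have "s * u \<le> 1"
      using assms(5) s by (simp add: field_simps)
    finally show "0 \<le> 1 - s ^ (2 * i + 1) * u" by simp
    have "s ^ (2 * i + 1) \<le> u"
      using pw(1)[of i] assms(4) by linarith
    then show "0 \<le> 1 - s ^ (2 * i + 1) / u"
      using u by simp
  qed
  have l: "0 \<le> l i" for i
    unfolding l_def by (intro mult_nonneg_nonneg nonneg) auto
  have lr: "l i < r i" for i
    unfolding l_def r_def using assms s u pw[of i] by (intro theta_factor_compare) auto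
  \<comment> \<open>Strict inequalities between factors could degenerate to equality in the limit.
    The quotient of the factors at index 0 is a fixed constant below 1 that survives; the products
    run to \<open>Suc N\<close> so that this factor is always present.\<close>
  define \<kappa> where "\<kappa> = l 0 / r 0"
  have r0: "r 0 > 0"
    using l[of 0] lr[of 0] by linarith
  have \<kappa>: "\<kappa> < 1"
    using lr[of 0] r0 by (simp add: \<kappa>_def)
  have prod: "(\<Prod>i<Suc N. l i) \<le> \<kappa> * (\<Prod>i<Suc N. r i)" for N
  proof (induction N)
    case 0
    then show ?case using r0 by (simp add: \<kappa>_def)
  next
    case (Suc N)
    have "0 \<le> \<kappa> * (\<Prod>i<Suc N. r i)"
      using Suc l by (smt (verit) prod_nonneg)
    then have "(\<Prod>i<Suc N. l i) * l (Suc N) \<le> \<kappa> * (\<Prod>i<Suc N. r i) * r (Suc N)"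
      using Suc l lr[of "Suc N"] by (intro mult_mono) auto
    then show ?case by simp
  qed
  have Gl: "(\<Prod>i<N. l i) = G s (- u) N * G p 1 N" and Gr: "(\<Prod>i<N. r i) = G s u N * G p (- 1) N" for N
    by (simp_all add: l_def r_def G_def power2_eq_square flip: prod.distrib)
  have "theta s (- u) * theta p 1 \<le> \<kappa> * (theta s u * theta p (- 1))"
  proof (rule LIMSEQ_le)
    show "(\<lambda>N. (D s (Suc N) * G s (- u) (Suc N)) * (D p (Suc N) * G p 1 (Suc N))) \<longlonglongrightarrow> theta s (- u) * theta p 1"
      using assms s p u by (intro tendsto_mult LIMSEQ_Suc[OF lim]) auto
    show "(\<lambda>N. \<kappa> * ((D s (Suc N) * G s u (Suc N)) * (D p (Suc N) * G p (- 1) (Suc N)))) \<longlonglongrightarrow> \<kappa> * (theta s u * theta p (- 1))"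
      using assms s p u by (intro tendsto_mult LIMSEQ_Suc[OF lim] tendsto_const) auto
    have "(D s (Suc N) * G s (- u) (Suc N)) * (D p (Suc N) * G p 1 (Suc N))
        \<le> \<kappa> * ((D s (Suc N) * G s u (Suc N)) * (D p (Suc N) * G p (- 1) (Suc N)))" for N
      using mult_left_mono[OF prod[of N, unfolded Gl Gr], of "D s (Suc N) * D p (Suc N)"]
        D[of s "Suc N"] D[of p "Suc N"] assms s p by (simp add: mult_ac)
    then show "\<exists>M. \<forall>N\<ge>M. (D s (Suc N) * G s (- u) (Suc N)) * (D p (Suc N) * G p 1 (Suc N))
        \<le> \<kappa> * ((D s (Suc N) * G s u (Suc N)) * (D p (Suc N) * G p (- 1) (Suc N)))"
      by blast
  qed
  also have "\<dots> < 1 * (theta s u * theta p (- 1))"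
    using \<kappa> theta_pos[of s u] theta_minus_one_pos[of p] assms s p u
    by (intro mult_strict_right_mono) auto
  finally have "theta s (- u) * theta p 1 < theta s u * theta p (- 1)"
    by simp
  moreover have "theta s (- u) \<ge> 0"
  proof (rule tendsto_lowerbound[OF lim])
    have "0 \<le> D s N * G s (- u) N" for N
      unfolding G_def using nonneg D[of s N] s assms(3)
      by (intro mult_nonneg_nonneg prod_nonneg) (auto simp: less_imp_le)
    then show "\<forall>\<^sub>F N in sequentially. 0 \<le> D s N * G s (- u) N" by simp
  qed (use s u assms in auto)
  ultimately show ?thesis by simp
qed

text \<open>Quasi-periodicity: complete the square in \<open>k\<^sup>2 + 2 * n * k\<close> and shift
  the summation index.\<close>

lemma theta_shift:
  assumes "0 < s" "u \<noteq> 0"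
  shows "theta s (s powr (2 * real_of_int n) * u) = s powr (- (real_of_int n)\<^sup>2) * u powi (- n) * theta s u"
proof -
  have "theta s (s powr (2 * real_of_int n) * u) =
    (\<Sum>\<^sub>\<infinity>k. s powr (- (real_of_int n)\<^sup>2) * u powi (- n) * (s powr (real_of_int (k + n))\<^sup>2 * u powi (k + n)))"
    unfolding theta_def
  proof (rule infsum_cong)
    fix k :: int
    have "(s powr (2 * real_of_int n)) powi k = s powr (2 * real_of_int n * real_of_int k)"
      using assms powr_real_of_int'[of "s powr (2 * real_of_int n)" k] by (simp add: powr_powr)
    moreover have "s powr (- (real_of_int n)\<^sup>2) * s powr (real_of_int (k + n))\<^sup>2 =
        s powr (real_of_int k)\<^sup>2 * s powr (2 * real_of_int n * real_of_int k)"
      unfolding powr_add[symmetric] by (simp add: power2_eq_square algebra_simps)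
    moreover have "u powi (- n) * u powi (k + n) = u powi k"
      using assms by (simp flip: power_int_add)
    ultimately show "s powr (real_of_int k)\<^sup>2 * (s powr (2 * real_of_int n) * u) powi k =
      s powr (- (real_of_int n)\<^sup>2) * u powi (- n) * (s powr (real_of_int (k + n))\<^sup>2 * u powi (k + n))"
      by (simp add: power_int_mult_distrib mult_ac)
  qed
  also have "\<dots> = s powr (- (real_of_int n)\<^sup>2) * u powi (- n) *
      (\<Sum>\<^sub>\<infinity>k. s powr (real_of_int (k + n))\<^sup>2 * u powi (k + n))"
    by (rule infsum_cmult_right')
  also have "(\<Sum>\<^sub>\<infinity>k. s powr (real_of_int (k + n))\<^sup>2 * u powi (k + n)) = theta s u"
    unfolding theta_def
    by (rule infsum_reindex_bij_witness[of _ "\<lambda>k. k - n" "\<lambda>k. k + n"]) auto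
  finally show ?thesis .
qed

text \<open>Multiplying \<open>u\<close> by an even power of \<open>s\<close> rescales
  \<open>theta s u\<close> and \<open>|theta s (- u)|\<close> by the same positive factor, so
  \<open>u\<close> can be moved into the range of \<open>theta_compare_fundamental\<close>.\<close>

lemma theta_compare:
  assumes "0 < p" "p < s" "s < 1" "u > 0"
  shows "\<bar>theta s (- u)\<bar> * theta p 1 < theta s u * theta p (- 1)"
proof -
  have s: "0 < s" using assms by auto
  \<comment> \<open>Rounding to the nearest integer brings the exponent
    \<open>2 * n + log s u\<close> of \<open>w\<close> into \<open>[-1, 1]\<close>.\<close>
  define n where "n = - round (log s u / 2)"
  define w where "w = s powr (2 * real_of_int n) * u"
  have u: "u = s powr (log s u)"
    using assms s by simp
  have w: "w = s powr (2 * real_of_int n + log s u)"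
    unfolding w_def powr_add using assms s by simp
  have "\<bar>2 * real_of_int n + log s u\<bar> \<le> 1"
    using of_int_round_abs_le[of "log s u / 2"] by (simp add: n_def abs_if split: if_splits)
  then have "s powr 1 \<le> w" "w \<le> s powr (- 1)"
    unfolding w using s assms(3)
      powr_mono'[of "2 * real_of_int n + log s u" 1 s] powr_mono'[of "- 1" "2 * real_of_int n + log s u" s]
    by (auto simp only: abs_le_iff)
  then have "s \<le> w" "w \<le> 1 / s"
    using s by (auto simp: powr_minus_divide)
  from theta_compare_fundamental[OF assms(1-3) this]
  have ineq: "\<bar>theta s (- w)\<bar> * theta p 1 < theta s w * theta p (- 1)" .
  define c where "c = s powr (- (real_of_int n)\<^sup>2) * u powi (- n)"
  have c: "c > 0"
    using assms s by (simp add: c_def)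
  have "theta s w = c * theta s u"
    unfolding w_def c_def using assms s by (intro theta_shift) auto
  moreover have "\<bar>theta s (- w)\<bar> = c * \<bar>theta s (- u)\<bar>"
    using theta_shift[of s "- u" n] assms s
    by (simp add: w_def c_def abs_mult power_int_abs)
  ultimately have "c * (\<bar>theta s (- u)\<bar> * theta p 1) < c * (theta s u * theta p (- 1))"
    using ineq by (simp add: mult_ac)
  then show ?thesis
    using c by simp
qed

section \<open>Oscillation on the negative axis\<close>

text \<open>At \<open>t = - p powr (- 2 * m)\<close> the \<open>n\<close>-th term of the series is, up to a common factor,
  \<open>e n * p\<^bsup>(n - m)\<^sup>2\<^esup> * (- 1)\<^bsup>n\<^esup>\<close>: the whole sum concentrates around \<open>n = m\<close>
  and has the sign \<open>(- 1) ^ m\<close> as soon as \<open>m\<close> is large.\<close>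

lemma infinite_negative_zeros:
  fixes e b :: "nat \<Rightarrow> real"
  assumes p: "0 < p" "p < 1"
    and bnd: "\<And>m n. \<bar>e n\<bar> \<le> C * D ^ nat \<bar>int n - int m\<bar> * b m" and D: "D \<ge> 1"
    and b: "\<And>m. b m > 0"
    and lim: "\<And>k. (\<lambda>m. e (nat (int m + k)) / b m - (A + (- 1) ^ nat (int m + k) * B)) \<longlonglongrightarrow> 0"
    and dom: "\<bar>B\<bar> * theta p 1 < A * theta p (- 1)"
  shows "infinite {t. t < 0 \<and> (\<Sum>n. e n * p powr (real n)\<^sup>2 * t ^ n) = 0}"
proof -
  define f where "f t = (\<Sum>n. e n * p powr (real n)\<^sup>2 * t ^ n)" for t
  have C: "C \<ge> 0"
    using bnd[of 0 0] b[of 0] by (simp add: zero_le_mult_iff) (smt (verit) abs_ge_zero mult_less_0_iff)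
  \<comment> \<open>The growth bound at \<open>m = 0\<close> makes \<open>e\<close> at most
    geometric, which the Gaussian factor beats for every \<open>t\<close>.\<close>
  have smb: "summable (\<lambda>n. norm (e n * p powr (real n)\<^sup>2 * t ^ n))" for t
  proof (rule summable_comparison_test)
    show "summable (\<lambda>n. C * b 0 * (p powr (real n)\<^sup>2 * (D * \<bar>t\<bar>) ^ n))"
      by (intro summable_mult summable_gaussian p)
    have "norm (norm (e n * p powr (real n)\<^sup>2 * t ^ n)) \<le> C * b 0 * (p powr (real n)\<^sup>2 * (D * \<bar>t\<bar>) ^ n)" for n
      using mult_right_mono[OF bnd[of n 0], of "p powr (real n)\<^sup>2 * \<bar>t\<bar> ^ n"]
      by (simp add: abs_mult power_abs power_mult_distrib mult_ac)
    then show "\<exists>N. \<forall>n\<ge>N. norm (norm (e n * p powr (real n)\<^sup>2 * t ^ n)) \<le> C * b 0 * (p powr (real n)\<^sup>2 * (D * \<bar>t\<bar>) ^ n)"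
      by blast
  qed
  have cont: "isCont f t" for t
    unfolding f_def by (rule isCont_powser_converges_everywhere) (rule summable_norm_cancel[OF smb])
  define T where "T m = - (p powr (- 2 * real m))" for m
  have T: "T (Suc m) < T m" "T m < 0" for m
    using p by (auto simp: T_def intro!: powr_less_mono')
  \<comment> \<open>Coefficients recentred at \<open>m\<close> and normalised by \<open>b m\<close>;
    zero where the original index \<open>m + k\<close> would be negative.\<close>
  define a where "a m k = (if 0 \<le> int m + k then e (nat (int m + k)) / b m else 0)" for m k
  define th where "th k = p powr (real_of_int k)\<^sup>2 * (- 1) powi k" for k
  have th: "\<bar>th k\<bar> = p powr (real_of_int k)\<^sup>2" for k
    by (simp add: th_def abs_mult power_int_abs)
  have th_summable: "th summable_on UNIV"
    unfolding th_def using p by (rule theta_summable)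
  have value_T: "(- 1) ^ m * f (T m) = p powr (- (real m)\<^sup>2) * b m * (\<Sum>\<^sub>\<infinity>k. a m k * th k)"
    and summable_T: "(\<lambda>k. a m k * th k) summable_on UNIV" for m
  proof -
    have "((\<lambda>n. e n * p powr (real n)\<^sup>2 * T m ^ n) has_sum f (T m)) UNIV"
      unfolding f_def by (intro norm_summable_imp_has_sum summable_sums smb) (rule summable_norm_cancel[OF smb])
    then have "((\<lambda>n. e n * p powr (real n)\<^sup>2 * T m ^ n * ((- 1) ^ m * p powr (real m)\<^sup>2 / b m))
        has_sum f (T m) * ((- 1) ^ m * p powr (real m)\<^sup>2 / b m)) UNIV"
      by (rule has_sum_cmult_left)
    also have "(\<lambda>n. e n * p powr (real n)\<^sup>2 * T m ^ n * ((- 1) ^ m * p powr (real m)\<^sup>2 / b m)) =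
      (\<lambda>n. a m (int n - int m) * th (int n - int m))"
    proof
      fix n
      have "T m ^ n = (- 1) ^ n * p powr (- 2 * real m * real n)"
        using p by (simp add: T_def power_minus[of "p powr _"] powr_power mult.commute)
      moreover have "p powr (real n)\<^sup>2 * p powr (- 2 * real m * real n) * p powr (real m)\<^sup>2 =
          p powr (real_of_int (int n - int m))\<^sup>2"
        unfolding powr_add[symmetric] by (simp add: power2_eq_square algebra_simps)
      moreover have "(- 1) ^ n * (- 1) ^ m = (- 1 :: real) powi (int n - int m)"
        by (simp add: power_int_diff) (simp add: field_simps flip: power_mult_distrib)
      ultimately show "e n * p powr (real n)\<^sup>2 * T m ^ n * ((- 1) ^ m * p powr (real m)\<^sup>2 / b m) =
          a m (int n - int m) * th (int n - int m)"
        by (simp add: a_def th_def mult_ac)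
    qed
    also have "(\<dots> has_sum f (T m) * ((- 1) ^ m * p powr (real m)\<^sup>2 / b m)) UNIV \<longleftrightarrow>
      ((\<lambda>k. a m k * th k) has_sum f (T m) * ((- 1) ^ m * p powr (real m)\<^sup>2 / b m)) {- int m..}"
      by (rule has_sum_reindex_bij_witness[of _ "\<lambda>k. nat (k + int m)" "\<lambda>n. int n - int m"]) auto
    also have "\<dots> \<longleftrightarrow> ((\<lambda>k. a m k * th k) has_sum f (T m) * ((- 1) ^ m * p powr (real m)\<^sup>2 / b m)) UNIV"
      by (rule has_sum_cong_neutral) (auto simp: a_def)
    finally have "((\<lambda>k. a m k * th k) has_sum f (T m) * ((- 1) ^ m * p powr (real m)\<^sup>2 / b m)) UNIV" .
    then show "(\<lambda>k. a m k * th k) summable_on UNIV"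
      and "(- 1) ^ m * f (T m) = p powr (- (real m)\<^sup>2) * b m * (\<Sum>\<^sub>\<infinity>k. a m k * th k)"
      using b[of m] p by (auto simp: has_sum_iff powr_minus field_simps)
  qed
  \<comment> \<open>The limiting shape still depends on the parity of \<open>m\<close>. Hence the
    difference from \<open>g m\<close> is shown to vanish, rather than a limit of the sums
    themselves.\<close>
  define g where "g m k = (A + (- 1) ^ m * (- 1) powi k * B) * th k" for m k
  have g_eq: "g m k = A * th k + (- 1) ^ m * B * (p powr (real_of_int k)\<^sup>2 * 1 powi k)" for m k
    by (simp add: g_def th_def algebra_simps flip: power_int_mult_distrib)
  have g_summable: "g m summable_on UNIV"
    and g_sum: "(\<Sum>\<^sub>\<infinity>k. g m k) = A * theta p (- 1) + (- 1) ^ m * B * theta p 1" for m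
  proof -
    have 1: "(\<lambda>k. A * th k) summable_on UNIV"
      by (intro summable_on_cmult_right th_summable)
    have 2: "(\<lambda>k. (- 1) ^ m * B * (p powr (real_of_int k)\<^sup>2 * 1 powi k)) summable_on UNIV"
      using p by (intro summable_on_cmult_right theta_summable)
    show "g m summable_on UNIV"
      unfolding g_eq[abs_def] using 1 2 by (rule summable_on_add)
    show "(\<Sum>\<^sub>\<infinity>k. g m k) = A * theta p (- 1) + (- 1) ^ m * B * theta p 1"
      unfolding g_eq infsum_add[OF 1 2] by (simp add: infsum_cmult_right' theta_def th_def)
  qed
  have "(\<lambda>m. \<Sum>\<^sub>\<infinity>k. a m k * th k - g m k) \<longlonglongrightarrow> (\<Sum>\<^sub>\<infinity>k::int. 0)"
  proof (rule infsum_tendsto_dominated)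
    \<comment> \<open>Since \<open>D ^ |k|\<close> is at most
      \<open>D powi k + inverse D powi k\<close>, a combination of three theta series serves as
      majorant.\<close>
    show "(\<lambda>k. C * (p powr (real_of_int k)\<^sup>2 * D powi k) + C * (p powr (real_of_int k)\<^sup>2 * inverse D powi k)
        + (\<bar>A\<bar> + \<bar>B\<bar>) * (p powr (real_of_int k)\<^sup>2 * 1 powi k)) summable_on UNIV"
      using p by (intro summable_on_add summable_on_cmult_right theta_summable)
    show "\<bar>a m k * th k - g m k\<bar> \<le> C * (p powr (real_of_int k)\<^sup>2 * D powi k)
        + C * (p powr (real_of_int k)\<^sup>2 * inverse D powi k)
        + (\<bar>A\<bar> + \<bar>B\<bar>) * (p powr (real_of_int k)\<^sup>2 * 1 powi k)" for m k
    proof -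
      have "\<bar>a m k\<bar> \<le> C * D ^ nat \<bar>k\<bar>"
        using bnd[of "nat (int m + k)" m] b[of m] C D
        by (auto simp: a_def field_simps abs_mult)
      also have "D ^ nat \<bar>k\<bar> \<le> D powi k + inverse D powi k"
        using D by (cases "k \<ge> 0") (auto simp: power_int_def)
      finally have "\<bar>a m k\<bar> \<le> C * (D powi k + inverse D powi k)"
        using C by (simp add: mult_left_mono)
      moreover have "\<bar>A + (- 1) ^ m * (- 1) powi k * B\<bar> \<le> \<bar>A\<bar> + \<bar>B\<bar>"
        by (rule order_trans[OF abs_triangle_ineq]) (simp add: abs_mult power_int_abs)
      ultimately have "\<bar>a m k - (A + (- 1) ^ m * (- 1) powi k * B)\<bar> \<le> C * (D powi k + inverse D powi k) + (\<bar>A\<bar> + \<bar>B\<bar>)"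
        by (rule order_trans[OF abs_triangle_ineq4 add_mono])
      then have "\<bar>a m k - (A + (- 1) ^ m * (- 1) powi k * B)\<bar> * p powr (real_of_int k)\<^sup>2 \<le>
          (C * (D powi k + inverse D powi k) + (\<bar>A\<bar> + \<bar>B\<bar>)) * p powr (real_of_int k)\<^sup>2"
        by (rule mult_right_mono) simp
      moreover have "\<bar>a m k * th k - g m k\<bar> =
          \<bar>a m k - (A + (- 1) ^ m * (- 1) powi k * B)\<bar> * p powr (real_of_int k)\<^sup>2"
        unfolding g_def th[symmetric] abs_mult[symmetric] by (simp only: left_diff_distrib)
      ultimately show ?thesis
        by (simp add: algebra_simps)
    qed
    show "(\<lambda>m. a m k * th k - g m k) \<longlonglongrightarrow> 0" for k
    proof -
      have "(\<lambda>m. (e (nat (int m + k)) / b m - (A + (- 1) ^ nat (int m + k) * B)) * th k) \<longlonglongrightarrow> 0"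
        by (rule tendsto_mult_left_zero[OF lim])
      then show ?thesis
      proof (rule Lim_transform_eventually)
        show "\<forall>\<^sub>F m in sequentially. (e (nat (int m + k)) / b m - (A + (- 1) ^ nat (int m + k) * B)) * th k
            = a m k * th k - g m k"
          using eventually_ge_at_top[of "nat \<bar>k\<bar>"]
        proof eventually_elim
          case (elim m)
          then have nonneg: "0 \<le> int m + k" by linarith
          then have "(- 1) ^ nat (int m + k) = (- 1 :: real) powi (int m + k)"
            by (simp add: power_int_def)
          also have "\<dots> = (- 1) ^ m * (- 1) powi k"
            by (simp add: power_int_add)
          finally show ?case
            using nonneg by (simp add: a_def g_def algebra_simps)
        qed
      qed
    qed
  qed
  then have "(\<lambda>m. \<bar>\<Sum>\<^sub>\<infinity>k. a m k * th k - g m k\<bar>) \<longlonglongrightarrow> 0"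
    by (simp add: tendsto_rabs_zero)
  moreover have "(\<Sum>\<^sub>\<infinity>k. a m k * th k - g m k) = (\<Sum>\<^sub>\<infinity>k. a m k * th k) - (\<Sum>\<^sub>\<infinity>k. g m k)" for m
    using infsum_add[OF summable_T[of m] summable_on_uminus[THEN iffD2, OF g_summable[of m]]]
    by (simp add: infsum_uminus)
  ultimately have "(\<lambda>m. \<bar>(\<Sum>\<^sub>\<infinity>k. a m k * th k) - (A * theta p (- 1) + (- 1) ^ m * B * theta p 1)\<bar>) \<longlonglongrightarrow> 0"
    by (simp add: g_sum)
  \<comment> \<open>The gap in \<open>dom\<close> is the tolerance: within it the sum stays positive
    for either parity of \<open>m\<close>.\<close>
  then have "\<forall>\<^sub>F m in sequentially. \<bar>(\<Sum>\<^sub>\<infinity>k. a m k * th k) - (A * theta p (- 1) + (- 1) ^ m * B * theta p 1)\<bar>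
      < A * theta p (- 1) - \<bar>B\<bar> * theta p 1"
    using dom by (intro order_tendstoD) auto
  then have "\<forall>\<^sub>F m in sequentially. (- 1) ^ m * f (T m) > 0"
  proof eventually_elim
    case (elim m)
    have "\<bar>(- 1) ^ m * B * theta p 1\<bar> = \<bar>B\<bar> * theta p 1"
      using theta_pos[of p 1] p by (simp add: abs_mult)
    then have "(\<Sum>\<^sub>\<infinity>k. a m k * th k) > 0"
      using elim by linarith
    then show ?case
      unfolding value_T using b p by simp
  qed
  then obtain M where M: "\<And>m. m \<ge> M \<Longrightarrow> (- 1) ^ m * f (T m) > 0"
    unfolding eventually_sequentially by blast
  \<comment> \<open>The sign of \<open>f\<close> alternates along \<open>T m\<close>, so the
    intermediate value theorem gives a zero between \<open>T (Suc m)\<close> and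
    \<open>T m\<close>.\<close>
  have zero: "\<exists>t\<le>T m. f t = 0" if m: "m \<ge> M" for m
  proof -
    have "f (T m) * f (T (Suc m)) < 0"
      using mult_pos_pos[OF M[of m] M[of "Suc m"]] m
      by (simp add: mult_ac flip: power_mult_distrib)
    then have "(f (T (Suc m)) \<le> 0 \<and> 0 \<le> f (T m)) \<or> (f (T m) \<le> 0 \<and> 0 \<le> f (T (Suc m)))"
      by (auto simp: mult_less_0_iff)
    then have "\<exists>t\<ge>T (Suc m). t \<le> T m \<and> f t = 0"
      using IVT[of f "T (Suc m)" 0 "T m"] IVT2[of f "T m" 0 "T (Suc m)"] T(1)[of m] cont
      by (auto simp: less_imp_le)
    then show ?thesis by blast
  qed
  show ?thesis
  proof
    assume "finite {t. t < 0 \<and> (\<Sum>n. e n * p powr (real n)\<^sup>2 * t ^ n) = 0}"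
    then have "finite {t. t < 0 \<and> f t = 0}"
      by (simp add: f_def)
    then obtain R where R: "\<And>t. t < 0 \<Longrightarrow> f t = 0 \<Longrightarrow> R \<le> t"
      using bdd_below_finite unfolding bdd_below_def by blast
    \<comment> \<open>\<open>T m\<close> tends to minus infinity, so there are zeros below any lower
      bound \<open>R\<close> of a supposedly finite zero set.\<close>
    have "1 < (inverse p)\<^sup>2"
      using p by (simp add: one_less_inverse one_less_power)
    then have "\<forall>\<^sub>F m in sequentially. \<bar>R\<bar> + 1 \<le> (inverse p)\<^sup>2 ^ m"
      using filterlim_at_infinity_imp_norm_at_top[OF filterlim_realpow_sequentially_gt1, of "(inverse p)\<^sup>2"]
      by (simp add: filterlim_at_top norm_power)
    then have "\<forall>\<^sub>F m in sequentially. T m < R \<and> m \<ge> M"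
      using eventually_ge_at_top[of M]
    proof eventually_elim
      case (elim m)
      have "p powr (- 2 * real m) = inverse (p powr real (2 * m))"
        by (simp flip: powr_minus)
      also have "\<dots> = (inverse p)\<^sup>2 ^ m"
        using p by (simp only: powr_realpow power_mult power_inverse)
      finally show ?case
        using elim by (simp add: T_def)
    qed
    then obtain m where m: "T m < R" "m \<ge> M"
      by (auto dest: eventually_happens)
    then show False
      using zero[OF m(2)] R T(2)[of m] by (meson less_le_trans not_less order_le_less_trans)
  qed
qed

lemma infinite_negative_zeros_scale:
  fixes c :: "nat \<Rightarrow> real"
  assumes "infinite {t. t < 0 \<and> (\<Sum>n. c n * t ^ n) = 0}" and L: "L > 0"
  shows "infinite {t. t < 0 \<and> (\<Sum>n. c n * L ^ n * t ^ n) = 0}"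
proof -
  have "infinite ((\<lambda>t. t / L) ` {t. t < 0 \<and> (\<Sum>n. c n * t ^ n) = 0})"
    using assms by (subst finite_image_iff) (auto simp: inj_on_def)
  moreover have "(\<lambda>t. t / L) ` {t. t < 0 \<and> (\<Sum>n. c n * t ^ n) = 0} \<subseteq>
      {t. t < 0 \<and> (\<Sum>n. c n * L ^ n * t ^ n) = 0}"
    using L by (auto simp: power_divide divide_neg_pos)
  ultimately show ?thesis
    using finite_subset by blast
qed

text \<open>Dividing by \<open>L ^ n\<close> turns the limiting quotient into 1, so \<open>e\<close>
  is locally almost constant: \<open>infinite_negative_zeros\<close> applies with
  \<open>b = e\<close>, \<open>A = 1\<close>, \<open>B = 0\<close>. The quotients and their inverses
  converge, hence are bounded, and this bound yields \<open>D\<close>.\<close>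

lemma infinite_negative_zeros_ratio:
  fixes a :: "nat \<Rightarrow> real"
  assumes p: "0 < p" "p < 1" and a: "\<And>n. a n > 0"
    and ratio: "(\<lambda>n. a (Suc n) / a n) \<longlonglongrightarrow> L" and L: "L > 0"
  shows "infinite {t. t < 0 \<and> (\<Sum>n. a n * p powr (real n)\<^sup>2 * t ^ n) = 0}"
proof -
  define e where "e n = a n / L ^ n" for n
  have e: "e n > 0" for n
    using a L by (simp add: e_def)
  have "(\<lambda>n. a (Suc n) / a n / L) \<longlonglongrightarrow> L / L"
    using L by (intro tendsto_intros ratio) auto
  moreover have "a (Suc n) / a n / L = e (Suc n) / e n" for n
    using L by (simp add: e_def field_simps)
  ultimately have lim1: "(\<lambda>n. e (Suc n) / e n) \<longlonglongrightarrow> 1"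
    using L by simp
  have shift_lim: "(\<lambda>m. e (m + j) / e m) \<longlonglongrightarrow> 1" for j
  proof (induction j)
    case (Suc j)
    have "(\<lambda>m. e (Suc (m + j)) / e (m + j) * (e (m + j) / e m)) \<longlonglongrightarrow> 1 * 1"
      by (intro tendsto_mult Suc LIMSEQ_ignore_initial_segment[OF lim1, of j])
    moreover have "e (Suc (m + j)) / e (m + j) * (e (m + j) / e m) = e (m + Suc j) / e m" for m
      using e[of "m + j"] by simp
    ultimately show ?case by (simp only: mult_1)
  qed (use e in \<open>simp add: less_imp_neq[symmetric]\<close>)
  have "Bseq (\<lambda>n. e (Suc n) / e n)" "Bseq (\<lambda>n. inverse (e (Suc n) / e n))"
    using lim1 tendsto_inverse[OF lim1] by (auto intro!: convergent_imp_Bseq convergentI)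
  then obtain D1 D2 where D1: "\<And>n. norm (e (Suc n) / e n) \<le> D1"
    and D2: "\<And>n. norm (inverse (e (Suc n) / e n)) \<le> D2"
    unfolding Bseq_def by blast
  define D where "D = max 1 (max D1 D2)"
  have D: "D \<ge> 1"
    by (simp add: D_def)
  have step: "e (Suc n) \<le> D * e n" "e n \<le> D * e (Suc n)" for n
  proof -
    have "e (Suc n) / e n \<le> D" "e n / e (Suc n) \<le> D"
      using D1[of n] D2[of n] e[of n] e[of "Suc n"] by (auto simp: D_def)
    then show "e (Suc n) \<le> D * e n" "e n \<le> D * e (Suc n)"
      using e[of n] e[of "Suc n"] by (auto simp: pos_divide_le_eq)
  qed
  have up: "e (m + j) \<le> D ^ j * e m" for m j
  proof (induction j)
    case (Suc j)
    have "e (m + Suc j) \<le> D * e (m + j)"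
      using step(1)[of "m + j"] by simp
    also have "\<dots> \<le> D * (D ^ j * e m)"
      using D Suc by (intro mult_left_mono) auto
    finally show ?case by simp
  qed simp
  have down: "e m \<le> D ^ j * e (m + j)" for m j
  proof (induction j)
    case (Suc j)
    have "e m \<le> D ^ j * e (m + j)" by (rule Suc)
    also have "\<dots> \<le> D ^ j * (D * e (m + Suc j))"
      using D step(2)[of "m + j"] by (intro mult_left_mono) auto
    finally show ?case by (simp add: mult_ac)
  qed simp
  have "infinite {t. t < 0 \<and> (\<Sum>n. e n * p powr (real n)\<^sup>2 * t ^ n) = 0}"
  proof (rule infinite_negative_zeros[where b = e and C = 1 and D = D and A = 1 and B = 0])
    show "\<bar>e n\<bar> \<le> 1 * D ^ nat \<bar>int n - int m\<bar> * e m" for m n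
    proof (cases "m \<le> n")
      case True
      then show ?thesis
        using up[of m "n - m"] e[of n] by (simp add: nat_diff_distrib)
    next
      case False
      then show ?thesis
        using down[of n "m - n"] e[of n] by (simp add: nat_diff_distrib)
    qed
    show "(\<lambda>m. e (nat (int m + k)) / e m - (1 + (- 1) ^ nat (int m + k) * 0)) \<longlonglongrightarrow> 0" for k
    proof -
      have "(\<lambda>m. e (nat (int m + k)) / e m) \<longlonglongrightarrow> 1"
      proof (cases "k \<ge> 0")
        case True
        then show ?thesis
          using shift_lim[of "nat k"] by (simp add: nat_add_distrib)
      next
        case False
        define j where "j = nat (- k)"
        \<comment> \<open>For negative \<open>k\<close>, shift the index by \<open>j = - k\<close>
          and invert the limit for forward shifts.\<close>
        have "(\<lambda>m. inverse (e (m + j) / e m)) \<longlonglongrightarrow> inverse 1"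
          by (intro tendsto_inverse shift_lim) simp
        moreover have "inverse (e (m + j) / e m) = e (nat (int (m + j) + k)) / e (m + j)" for m
          using False by (simp add: j_def)
        ultimately have "(\<lambda>m. e (nat (int (m + j) + k)) / e (m + j)) \<longlonglongrightarrow> 1"
          by (simp only: inverse_1)
        then show ?thesis
          by (rule LIMSEQ_offset)
      qed
      then show ?thesis
        using tendsto_diff[of _ 1 sequentially "\<lambda>_. 1" 1] by simp
    qed
  qed (use p e D(1) theta_minus_one_pos[OF p] in \<open>auto simp: less_imp_le\<close>)
  from infinite_negative_zeros_scale[OF this L] show ?thesis
    using L by (simp add: e_def)
qed

section \<open>Rogers-Szego series\<close>

lemma summable_gaussian_bound:
  fixes c :: "nat \<Rightarrow> real"
  assumes "0 < p" "p < 1" and c: "\<And>n. \<bar>c n\<bar> \<le> K * real (Suc n) * p powr (real n)\<^sup>2"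
  shows "summable (\<lambda>n. norm (c n * t ^ n))"
proof (rule summable_comparison_test)
  have K: "K \<ge> 0"
    using c[of 0] assms(1) by simp
  have "norm (norm (c n * t ^ n)) \<le> K * (p powr (real n)\<^sup>2 * (2 * \<bar>t\<bar>) ^ n)" for n
  proof -
    \<comment> \<open>The linear factor is absorbed by doubling \<open>|t|\<close>.\<close>
    have "real (Suc n) \<le> 2 ^ n"
      using Suc_leI[OF less_exp[of n]] by (metis of_nat_le_iff of_nat_numeral of_nat_power)
    then have "K * real (Suc n) * p powr (real n)\<^sup>2 \<le> K * 2 ^ n * p powr (real n)\<^sup>2"
      using K by (intro mult_right_mono mult_left_mono) auto
    with c[of n] have "\<bar>c n\<bar> * \<bar>t\<bar> ^ n \<le> K * 2 ^ n * p powr (real n)\<^sup>2 * \<bar>t\<bar> ^ n"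
      by (intro mult_right_mono) auto
    then show ?thesis
      by (simp add: abs_mult power_abs power_mult_distrib mult_ac)
  qed
  then show "\<exists>N. \<forall>n\<ge>N. norm (norm (c n * t ^ n)) \<le> K * (p powr (real n)\<^sup>2 * (2 * \<bar>t\<bar>) ^ n)"
    by blast
  show "summable (\<lambda>n. K * (p powr (real n)\<^sup>2 * (2 * \<bar>t\<bar>) ^ n))"
    by (intro summable_mult summable_gaussian assms)
qed

lemma complex_series_zeros:
  fixes c :: "nat \<Rightarrow> real"
  assumes c: "\<And>n. c n > 0" and sm: "\<And>t. summable (\<lambda>n. c n * t ^ n)"
    and inf: "infinite {t. t < 0 \<and> (\<Sum>n. c n * t ^ n) = 0}"
  shows "infinite {z \<in> \<real>. (\<Sum>n. complex_of_real (c n) * z ^ n) = 0}"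
    and "\<And>z. z \<in> \<real> \<Longrightarrow> (\<Sum>n. complex_of_real (c n) * z ^ n) = 0 \<Longrightarrow> Re z < 0"
proof -
  have eq: "(\<Sum>n. complex_of_real (c n) * complex_of_real t ^ n) = complex_of_real (\<Sum>n. c n * t ^ n)" for t
    using suminf_of_real[OF sm[of t], where 'a = complex] by simp
  have "infinite (complex_of_real ` {t. t < 0 \<and> (\<Sum>n. c n * t ^ n) = 0})"
    using inf by (subst finite_image_iff) (auto simp: inj_on_def)
  moreover have "complex_of_real ` {t. t < 0 \<and> (\<Sum>n. c n * t ^ n) = 0} \<subseteq>
      {z \<in> \<real>. (\<Sum>n. complex_of_real (c n) * z ^ n) = 0}"
    by (auto simp: eq)
  ultimately show "infinite {z \<in> \<real>. (\<Sum>n. complex_of_real (c n) * z ^ n) = 0}"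
    using finite_subset by blast
  fix z :: complex
  assume z: "z \<in> \<real>" and zero: "(\<Sum>n. complex_of_real (c n) * z ^ n) = 0"
  from z obtain t where t: "z = complex_of_real t"
    by (auto elim: Reals_cases)
  show "Re z < 0"
  proof (rule ccontr)
    assume "\<not> Re z < 0"
    then have "t \<ge> 0" by (simp add: t)
    \<comment> \<open>The term at index 0 is \<open>c 0\<close>, positive even at
      \<open>t = 0\<close>.\<close>
    then have "(\<Sum>n. c n * t ^ n) > 0"
      using c by (intro suminf_pos2[OF sm, where i = 0]) (auto simp: less_imp_le)
    then show False
      using zero by (simp add: t eq)
  qed
qed

lemma power_over_qpoch_ratio:
  assumes "0 < q" "q < 1"
  shows "(\<lambda>k. (x ^ Suc k / qpoch q q (Suc k)) / (x ^ k / qpoch q q k)) \<longlonglongrightarrow> x"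
proof -
  have "(\<lambda>k. x / (1 - q * q ^ k)) \<longlonglongrightarrow> x / (1 - q * 0)"
    using assms by (intro tendsto_intros LIMSEQ_power_zero) auto
  moreover have "(x ^ Suc k / qpoch q q (Suc k)) / (x ^ k / qpoch q q k) = x / (1 - q * q ^ k)" for k
    using qpoch_self_pos[OF assms, of k] by (cases "x = 0") (auto simp: qpoch_Suc)
  ultimately show ?thesis by simp
qed

text \<open>The series is the q-exponential, formally \<open>1 / (x z; q)\<close> with infinitely
  many factors. Replacing \<open>z\<close> by \<open>q * z\<close> removes the first factor of the
  denominator.\<close>

lemma power_over_qpoch_fps:
  fixes q x :: real
  assumes "0 < q" "q < 1"
  shows "Abs_fps (\<lambda>k. q ^ k * (x ^ k / qpoch q q k)) =
    (1 - fps_const x * fps_X) * Abs_fps (\<lambda>k. x ^ k / qpoch q q k)"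
proof (rule fps_ext)
  fix n
  show "fps_nth (Abs_fps (\<lambda>k. q ^ k * (x ^ k / qpoch q q k))) n =
    fps_nth ((1 - fps_const x * fps_X) * Abs_fps (\<lambda>k. x ^ k / qpoch q q k)) n"
  proof (cases n)
    case (Suc k)
    have "1 - q * q ^ k \<noteq> 0"
      using assms power_Suc_less_one[of q k] by auto
    then show ?thesis
      using qpoch_self_pos[OF assms, of k]
      by (simp add: Suc left_diff_distrib mult.assoc qpoch_Suc field_simps)
  qed (simp add: left_diff_distrib mult.assoc)
qed

lemma rogers_szego_div_qpoch:
  assumes "0 < q" "q < 1"
  shows "rogers_szego n x y q / qpoch q q n =
    (\<Sum>k\<le>n. (x ^ k / qpoch q q k) * (y ^ (n - k) / qpoch q q (n - k)))"
  unfolding rogers_szego_def gauss_binom_def sum_divide_distrib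
  using qpoch_self_pos[OF assms, of n] by (intro sum.cong) auto

text \<open>Writing \<open>A(z)\<close> for the generating function of \<open>h\<^sub>n / (q; q)\<^sub>n\<close>, this compares
  coefficients in \<open>A(q z) = (1 - x z) (1 - y z) A(z)\<close>.\<close>

lemma rogers_szego_recurrence:
  assumes q: "0 < q" "q < 1"
  shows "rogers_szego 0 x y q = 1" and "rogers_szego (Suc 0) x y q = x + y"
    and "rogers_szego (Suc (Suc n)) x y q =
      (x + y) * rogers_szego (Suc n) x y q - (1 - q ^ Suc n) * x * y * rogers_szego n x y q"
proof -
  have pos: "qpoch q q k > 0" for k
    by (rule qpoch_self_pos[OF q])
  show "rogers_szego 0 x y q = 1"
    by (simp add: rogers_szego_def gauss_binom_def)
  show "rogers_szego (Suc 0) x y q = x + y"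
    using gauss_binom_0[OF q, of 1] gauss_binom_self[OF q, of 1] by (simp add: rogers_szego_def)
  define a where "a n = rogers_szego n x y q / qpoch q q n" for n
  define F where "F x = Abs_fps (\<lambda>k. x ^ k / qpoch q q k)" for x :: real
  have F: "Abs_fps (\<lambda>k. q ^ k * (x ^ k / qpoch q q k)) = (1 - fps_const x * fps_X) * F x" for x
    unfolding F_def by (rule power_over_qpoch_fps[OF q])
  have A: "F x * F y = Abs_fps a"
    by (rule fps_ext) (simp add: fps_mult_nth F_def a_def rogers_szego_div_qpoch[OF q] atLeast0AtMost)
  have "Abs_fps (\<lambda>k. q ^ k * (x ^ k / qpoch q q k)) * Abs_fps (\<lambda>k. q ^ k * (y ^ k / qpoch q q k)) =
      Abs_fps (\<lambda>n. q ^ n * a n)"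
  proof (rule fps_ext)
    fix n
    have "(\<Sum>k\<le>n. q ^ k * (x ^ k / qpoch q q k) * (q ^ (n - k) * (y ^ (n - k) / qpoch q q (n - k)))) =
       (\<Sum>k\<le>n. q ^ n * ((x ^ k / qpoch q q k) * (y ^ (n - k) / qpoch q q (n - k))))"
    proof (rule sum.cong)
      fix k assume "k \<in> {..n}"
      then have "q ^ n = q ^ k * q ^ (n - k)"
        by (simp flip: power_add)
      then show "q ^ k * (x ^ k / qpoch q q k) * (q ^ (n - k) * (y ^ (n - k) / qpoch q q (n - k))) =
          q ^ n * ((x ^ k / qpoch q q k) * (y ^ (n - k) / qpoch q q (n - k)))"
        by simp
    qed simp
    then show "fps_nth (Abs_fps (\<lambda>k. q ^ k * (x ^ k / qpoch q q k)) * Abs_fps (\<lambda>k. q ^ k * (y ^ k / qpoch q q k))) n =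
      fps_nth (Abs_fps (\<lambda>n. q ^ n * a n)) n"
      by (simp add: fps_mult_nth a_def rogers_szego_div_qpoch[OF q] atLeast0AtMost sum_distrib_left)
  qed
  then have "Abs_fps (\<lambda>n. q ^ n * a n) =
      ((1 - fps_const x * fps_X) * F x) * ((1 - fps_const y * fps_X) * F y)"
    by (simp only: F)
  also have "\<dots> = (1 - fps_const x * fps_X) * (1 - fps_const y * fps_X) * Abs_fps a"
    unfolding A[symmetric] by (simp only: mult_ac)
  also have "\<dots> = Abs_fps a - fps_const (x + y) * (fps_X * Abs_fps a)
      + fps_const (x * y) * (fps_X * (fps_X * Abs_fps a))"
    by (simp add: algebra_simps flip: fps_const_add fps_const_mult)
  finally have "fps_nth (Abs_fps (\<lambda>n. q ^ n * a n)) (Suc (Suc n)) =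
      fps_nth (Abs_fps a - fps_const (x + y) * (fps_X * Abs_fps a)
        + fps_const (x * y) * (fps_X * (fps_X * Abs_fps a))) (Suc (Suc n))"
    by simp
  then have rec: "(1 - q * q ^ Suc n) * a (Suc (Suc n)) = (x + y) * a (Suc n) - x * y * a n"
    by (simp add: algebra_simps)
  have "rogers_szego (Suc (Suc n)) x y q = qpoch q q (Suc n) * ((1 - q * q ^ Suc n) * a (Suc (Suc n)))"
    using pos[of "Suc (Suc n)"] unfolding a_def qpoch_Suc[of q q "Suc n"] by auto
  also have "\<dots> = (x + y) * (qpoch q q (Suc n) * a (Suc n)) -
      (1 - q ^ Suc n) * x * y * (qpoch q q n * a n)"
    unfolding rec by (simp add: qpoch_Suc algebra_simps)
  also have "\<dots> = (x + y) * rogers_szego (Suc n) x y q - (1 - q ^ Suc n) * x * y * rogers_szego n x y q"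
    using pos[of n] pos[of "Suc n"] by (simp add: a_def)
  finally show "rogers_szego (Suc (Suc n)) x y q =
      (x + y) * rogers_szego (Suc n) x y q - (1 - q ^ Suc n) * x * y * rogers_szego n x y q" .
qed

lemma rogers_szego_pos:
  assumes "0 < q" "q < 1" "x > 0" "y > 0"
  shows "rogers_szego n x y q > 0"
  unfolding rogers_szego_def gauss_binom_def
  using assms by (intro sum_pos mult_pos_pos divide_pos_pos qpoch_self_pos) auto

text \<open>The three-term recurrence becomes
  \<open>R (Suc n) = x + y - (1 - q ^ Suc n) * x * y / R n\<close>. By induction \<open>R\<close>
  stays above \<open>x\<close> and decreases, because a smaller \<open>R n\<close> and a smaller
  power of \<open>q\<close> both enlarge the subtracted fraction. So it converges to a limit at
  least \<open>x\<close>.\<close>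

lemma rogers_szego_ratio_limit:
  assumes q: "0 < q" "q < 1" and xy: "x > 0" "y > 0"
  obtains L where "L > 0" "(\<lambda>n. rogers_szego (Suc n) x y q / rogers_szego n x y q) \<longlonglongrightarrow> L"
proof -
  define R where "R n = rogers_szego (Suc n) x y q / rogers_szego n x y q" for n
  have h: "rogers_szego n x y q > 0" for n
    using rogers_szego_pos[OF q xy] .
  have R0: "R 0 = x + y"
    by (simp add: R_def rogers_szego_recurrence[OF q])
  have R_Suc: "R (Suc n) = (x + y) - (1 - q ^ Suc n) * x * y / R n" for n
    using h[of n] h[of "Suc n"]
    by (simp add: R_def rogers_szego_recurrence(3)[OF q, of n] field_simps)
  have lower: "x \<le> R n" for n
  proof (induction n)
    case (Suc n)
    have "(1 - q ^ Suc n) * x * y / R n \<le> 1 * x * y / x"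
      using Suc xy q by (intro frac_le mult_right_mono mult_nonneg_nonneg) (auto simp: power_le_one)
    then show ?case
      using xy by (simp add: R_Suc)
  qed (use R0 xy in simp)
  have "R (Suc n) \<le> R n" for n
  proof (induction n)
    case 0
    have "0 \<le> (1 - q ^ Suc 0) * x * y / R 0"
      using q xy lower[of 0] by (intro divide_nonneg_nonneg mult_nonneg_nonneg) auto
    then show ?case
      by (simp add: R_Suc R0)
  next
    case (Suc n)
    have "(1 - q ^ Suc n) * x * y / R n \<le> (1 - q ^ Suc (Suc n)) * x * y / R (Suc n)"
      using Suc xy q lower[of "Suc n"] power_decreasing[of "Suc n" "Suc (Suc n)" q]
        power_le_one[of q "Suc (Suc n)"]
      by (intro frac_le mult_right_mono mult_nonneg_nonneg) auto
    then show ?case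
      by (simp only: R_Suc[of "Suc n"] R_Suc[of n])
  qed
  then have "decseq R"
    by (rule decseq_SucI)
  then obtain L where L: "R \<longlonglongrightarrow> L" "\<And>n. L \<le> R n"
    using lower decseq_convergent[of R x] by blast
  have "x \<le> L"
    by (rule tendsto_lowerbound[OF L(1)]) (use lower in auto)
  then show ?thesis
    using that[of L] L(1) xy unfolding R_def by simp
qed

text \<open>Each quotient is at most \<open>1 / L\<close>. The weights \<open>w\<close> are constant
  for the Rogers-Szego series and carry the powers of \<open>q\<close> for the Stieltjes-Wigert
  series.\<close>

lemma sum_over_qpoch_bound:
  assumes q: "0 < q" "q < 1" and L: "L > 0" "\<And>k. L \<le> qpoch q q k"
    and xy: "0 \<le> x" "x \<le> 1" "0 \<le> y" "y \<le> 1" and w: "\<And>k. k \<le> n \<Longrightarrow> w k \<ge> 0" "\<And>k. k \<le> n \<Longrightarrow> w k \<le> W"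
  shows "(\<Sum>k\<le>n. w k * ((x ^ k / qpoch q q k) * (y ^ (n - k) / qpoch q q (n - k)))) \<le>
    1 / L\<^sup>2 * real (Suc n) * W"
proof -
  have le: "0 \<le> z ^ k / qpoch q q k" "z ^ k / qpoch q q k \<le> 1 / L" if "0 \<le> z" "z \<le> 1" for z k
    using that L qpoch_self_pos[OF q, of k] by (auto intro!: frac_le simp: power_le_one less_imp_le)
  have "(\<Sum>k\<le>n. w k * ((x ^ k / qpoch q q k) * (y ^ (n - k) / qpoch q q (n - k)))) \<le> (\<Sum>k\<le>n. W * (1 / L * (1 / L)))"
  proof (intro sum_mono mult_mono le xy mult_nonneg_nonneg)
    fix k assume "k \<in> {..n}"
    then show "w k \<le> W" "0 \<le> W" using w[of k] by auto
  qed (use L in auto)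
  then show ?thesis
    by (simp add: power2_eq_square)
qed

lemma rogers_szego_series_zeros:
  assumes q: "0 < q" "q < 1" and \<alpha>: "\<alpha> > 0" and x: "0 < x" "x < 1" and y: "0 < y" "y < 1"
  shows "infinite {z \<in> \<real>. rogers_szego_series \<alpha> x y q z = 0}"
    and "\<And>z. z \<in> \<real> \<Longrightarrow> rogers_szego_series \<alpha> x y q z = 0 \<Longrightarrow> Re z < 0"
proof -
  define p where "p = q powr \<alpha>"
  have p: "0 < p" "p < 1"
    using q \<alpha> powr_less_mono'[of q 0 \<alpha>] by (auto simp: p_def)
  have powr_p: "q powr (\<alpha> * (real n)\<^sup>2) = p powr (real n)\<^sup>2" for n
    by (simp add: p_def powr_powr)
  define a where "a n = rogers_szego n x y q / qpoch q q n" for n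
  have a: "a n > 0" for n
    using rogers_szego_pos[OF q x(1) y(1)] qpoch_self_pos[OF q] by (simp add: a_def)
  obtain L where L: "L > 0" "(\<lambda>n. rogers_szego (Suc n) x y q / rogers_szego n x y q) \<longlonglongrightarrow> L"
    using rogers_szego_ratio_limit[OF q x(1) y(1)] by blast
  \<comment> \<open>Passing from \<open>rogers_szego\<close> to \<open>a\<close> divides the
    quotients by \<open>1 - q * q ^ n\<close>, which tends to 1, so the limit is unchanged.\<close>
  have "(\<lambda>n. rogers_szego (Suc n) x y q / rogers_szego n x y q / (1 - q * q ^ n)) \<longlonglongrightarrow> L / (1 - q * 0)"
    using q by (intro tendsto_intros L LIMSEQ_power_zero) auto
  moreover have "rogers_szego (Suc n) x y q / rogers_szego n x y q / (1 - q * q ^ n) = a (Suc n) / a n" for n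
    using qpoch_self_pos[OF q, of n] by (simp add: a_def qpoch_Suc)
  ultimately have ratio: "(\<lambda>n. a (Suc n) / a n) \<longlonglongrightarrow> L"
    by simp
  obtain K where K: "K > 0" "\<And>k. K \<le> qpoch q q k"
    using qpoch_self_limit[OF q] by blast
  have bound: "a n \<le> 1 / K\<^sup>2 * real (Suc n)" for n
    unfolding a_def rogers_szego_div_qpoch[OF q]
    using sum_over_qpoch_bound[OF q K, of x y n "\<lambda>_. 1" 1] x y by simp
  then have "\<bar>a n * p powr (real n)\<^sup>2\<bar> \<le> 1 / K\<^sup>2 * real (Suc n) * p powr (real n)\<^sup>2" for n
    using a[of n] mult_right_mono[OF bound[of n], of "p powr (real n)\<^sup>2"] by (simp add: abs_mult)
  then have sm: "summable (\<lambda>n. a n * p powr (real n)\<^sup>2 * t ^ n)" for t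
    by (intro summable_norm_cancel[OF summable_gaussian_bound[OF p]])
  have eq: "rogers_szego_series \<alpha> x y q z = (\<Sum>n. complex_of_real (a n * p powr (real n)\<^sup>2) * z ^ n)" for z
    by (simp add: rogers_szego_series_def a_def powr_p)
  have pos: "0 < a n * p powr (real n)\<^sup>2" for n
    using a p by simp
  note zeros = complex_series_zeros[OF pos sm infinite_negative_zeros_ratio[OF p a ratio L(1)]]
  show "infinite {z \<in> \<real>. rogers_szego_series \<alpha> x y q z = 0}"
    unfolding eq by (rule zeros(1))
  show "\<And>z. z \<in> \<real> \<Longrightarrow> rogers_szego_series \<alpha> x y q z = 0 \<Longrightarrow> Re z < 0"
    unfolding eq by (rule zeros(2))
qed

section \<open>Stieltjes-Wigert series\<close>

lemma stieltjes_wigert_coeff: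
  assumes q: "0 < q" "q < 1"
  shows "stieltjes_wigert n x y q / qpoch q q n * q powr (\<alpha> * (real n)\<^sup>2) =
    (\<Sum>k\<le>n. q powr (\<alpha> * (real n)\<^sup>2 - real k * real (n - k)) *
      ((x ^ k / qpoch q q k) * (y ^ (n - k) / qpoch q q (n - k))))"
  unfolding stieltjes_wigert_def gauss_binom_def sum_divide_distrib sum_distrib_right
proof (rule sum.cong)
  fix k assume k: "k \<in> {..n}"
  have "real_of_int (int k * (int k - int n)) = - (real k * real (n - k))"
    using k by (simp add: of_nat_diff algebra_simps)
  then have "q powi (int k * (int k - int n)) = q powr (- (real k * real (n - k)))"
    using powr_real_of_int'[of q "int k * (int k - int n)"] q by simp
  then have "q powi (int k * (int k - int n)) * q powr (\<alpha> * (real n)\<^sup>2) =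
      q powr (\<alpha> * (real n)\<^sup>2 - real k * real (n - k))"
    by (simp flip: powr_add)
  then show "qpoch q q n / (qpoch q q k * qpoch q q (n - k)) * q powi (int k * (int k - int n)) * x ^ k *
      y ^ (n - k) / qpoch q q n * q powr (\<alpha> * (real n)\<^sup>2) =
    q powr (\<alpha> * (real n)\<^sup>2 - real k * real (n - k)) *
      ((x ^ k / qpoch q q k) * (y ^ (n - k) / qpoch q q (n - k)))"
    using qpoch_self_pos[OF q, of n] by (simp add: mult_ac)
qed simp

text \<open>Homogeneity of degree \<open>n\<close>; it trades negative parameters for the
  substitution of \<open>- z\<close> for \<open>z\<close>.\<close>

lemma stieltjes_wigert_minus:
  "stieltjes_wigert n (- x) (- y) q = (- 1) ^ n * stieltjes_wigert n x y q"
  unfolding stieltjes_wigert_def sum_distrib_left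
proof (rule sum.cong)
  fix k assume "k \<in> {..n}"
  then have "(- 1 :: real) ^ n = (- 1) ^ k * (- 1) ^ (n - k)"
    by (simp flip: power_add)
  then show "gauss_binom q n k * q powi (int k * (int k - int n)) * (- x) ^ k * (- y) ^ (n - k) =
      (- 1) ^ n * (gauss_binom q n k * q powi (int k * (int k - int n)) * x ^ k * y ^ (n - k))"
    unfolding power_minus[of x] power_minus[of y] by (simp only: mult_ac)
qed simp

text \<open>Only indices \<open>j = 2 * k - n\<close> of the parity of \<open>n\<close> occur, and
  their weights tend to \<open>1 / L\<^sup>2\<close>. The part of the theta series of this parity is
  half of \<open>theta s u + (- 1) ^ n * theta s (- u)\<close>.\<close>

lemma theta_parity_limit:
  assumes s: "0 < s" "s < 1" and q: "0 < q" "q < 1"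
    and L: "L > 0" "qpoch q q \<longlonglongrightarrow> L" "\<And>k. L \<le> qpoch q q k"
  shows "(\<lambda>n. (\<Sum>k\<le>n. s powr (real_of_int (2 * int k - int n))\<^sup>2 * u powi (2 * int k - int n) /
      (qpoch q q k * qpoch q q (n - k))) -
    (theta s u / (2 * L\<^sup>2) + (- 1) ^ n * (theta s (- u) / (2 * L\<^sup>2)))) \<longlonglongrightarrow> 0"
proof -
  define P where "P = qpoch q q"
  note L = L[folded P_def]
  have P: "P k > 0" for k
    unfolding P_def by (rule qpoch_self_pos[OF q])
  have PP: "0 \<le> 1 / (P i * P j)" "1 / (P i * P j) \<le> 1 / L\<^sup>2" for i j
    using P[of i] P[of j] L(1) L(3)[of i] L(3)[of j] unfolding power2_eq_square
    by (auto intro!: frac_le mult_mono simp: less_imp_le)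
  define t where "t j = s powr (real_of_int j)\<^sup>2 * u powi j" for j
  have t: "t summable_on UNIV"
    unfolding t_def by (rule theta_summable[OF s])
  \<comment> \<open>\<open>m n j\<close> recovers \<open>k\<close> from
    \<open>j = 2 * k - n\<close>, and \<open>m n (- j)\<close> recovers
    \<open>n - k\<close>.\<close>
  define m where "m n j = nat ((int n + j) div 2)" for n j
  define w where "w n j = (if \<bar>j\<bar> \<le> int n \<and> even (int n + j) then 1 / (P (m n j) * P (m n (- j))) else 0)" for n j
  \<comment> \<open>\<open>1 + (- 1) ^ (n + j)\<close> is twice the parity indicator. The target
    depends on \<open>n\<close>, so again a difference is shown to tend to 0.\<close>
  define h where "h n j = (1 + (- 1) ^ n * (- 1) powi j) / (2 * L\<^sup>2)" for n :: nat and j :: int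
  have h: "h n j = (if even (int n + j) then 1 / L\<^sup>2 else 0)" for n j
    by (auto simp: h_def power_int_minus_left uminus_power_if)
  have w_sum: "(\<Sum>\<^sub>\<infinity>j. w n j * t j) =
      (\<Sum>k\<le>n. s powr (real_of_int (2 * int k - int n))\<^sup>2 * u powi (2 * int k - int n) / (P k * P (n - k)))"
    and w_summable: "(\<lambda>j. w n j * t j) summable_on UNIV" for n
  proof -
    have zero: "w n j * t j = 0" if "j \<notin> (\<lambda>k. 2 * int k - int n) ` {..n}" for j
    proof (rule ccontr)
      assume "w n j * t j \<noteq> 0"
      then have j: "\<bar>j\<bar> \<le> int n" "even (int n + j)"
        by (auto simp: w_def split: if_splits)
      then have "j = 2 * int (m n j) - int n" "m n j \<le> n"
        by (auto simp: m_def)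
      with that show False by blast
    qed
    have "(\<Sum>\<^sub>\<infinity>j. w n j * t j) = (\<Sum>\<^sub>\<infinity>j\<in>(\<lambda>k. 2 * int k - int n) ` {..n}. w n j * t j)"
      by (rule infsum_cong_neutral) (use zero in auto)
    also have "\<dots> = (\<Sum>k\<le>n. w n (2 * int k - int n) * t (2 * int k - int n))"
      by (simp add: sum.reindex inj_on_def)
    also have "\<dots> = (\<Sum>k\<le>n. s powr (real_of_int (2 * int k - int n))\<^sup>2 * u powi (2 * int k - int n) / (P k * P (n - k)))"
    proof (rule sum.cong)
      fix k assume "k \<in> {..n}"
      then have "w n (2 * int k - int n) = 1 / (P k * P (n - k))"
        by (auto simp: w_def m_def nat_diff_distrib)
      then show "w n (2 * int k - int n) * t (2 * int k - int n) =
          s powr (real_of_int (2 * int k - int n))\<^sup>2 * u powi (2 * int k - int n) / (P k * P (n - k))"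
        by (simp add: t_def)
    qed simp
    finally show "(\<Sum>\<^sub>\<infinity>j. w n j * t j) = \<dots>" .
    have "(\<lambda>j. w n j * t j) summable_on (\<lambda>k. 2 * int k - int n) ` {..n}"
      by simp
    also have "?this \<longleftrightarrow> (\<lambda>j. w n j * t j) summable_on UNIV"
      by (rule summable_on_cong_neutral) (use zero in auto)
    finally show "(\<lambda>j. w n j * t j) summable_on UNIV" .
  qed
  have h_eq: "h n j * t j = 1 / (2 * L\<^sup>2) * t j +
      (- 1) ^ n * (1 / (2 * L\<^sup>2)) * (s powr (real_of_int j)\<^sup>2 * (- u) powi j)" for n j
  proof -
    have "(- u) powi j = (- 1) powi j * u powi j"
      by (simp flip: power_int_mult_distrib)
    then show ?thesis
      using L(1) by (simp add: h_def t_def field_simps)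
  qed
  have h_sum: "(\<Sum>\<^sub>\<infinity>j. h n j * t j) = theta s u / (2 * L\<^sup>2) + (- 1) ^ n * (theta s (- u) / (2 * L\<^sup>2))"
    and h_summable: "(\<lambda>j. h n j * t j) summable_on UNIV" for n
  proof -
    have 1: "(\<lambda>j. 1 / (2 * L\<^sup>2) * t j) summable_on UNIV"
      by (intro summable_on_cmult_right t)
    have 2: "(\<lambda>j. (- 1) ^ n * (1 / (2 * L\<^sup>2)) * (s powr (real_of_int j)\<^sup>2 * (- u) powi j)) summable_on UNIV"
      by (intro summable_on_cmult_right theta_summable[OF s])
    show "(\<lambda>j. h n j * t j) summable_on UNIV"
      unfolding h_eq by (rule summable_on_add[OF 1 2])
    show "(\<Sum>\<^sub>\<infinity>j. h n j * t j) = theta s u / (2 * L\<^sup>2) + (- 1) ^ n * (theta s (- u) / (2 * L\<^sup>2))"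
      unfolding h_eq infsum_add[OF 1 2] infsum_cmult_right' by (simp add: theta_def t_def)
  qed
  have m_lim: "filterlim (\<lambda>n. m n j) at_top sequentially" for j
    unfolding filterlim_at_top
  proof
    fix Z
    show "\<forall>\<^sub>F n in sequentially. Z \<le> m n j"
      using eventually_ge_at_top[of "2 * Z + nat \<bar>j\<bar>"] by eventually_elim (simp add: m_def; linarith)
  qed
  have "(\<lambda>n. \<Sum>\<^sub>\<infinity>j. (w n j - h n j) * t j) \<longlonglongrightarrow> (\<Sum>\<^sub>\<infinity>j::int. 0)"
  proof (rule infsum_tendsto_dominated)
    show "(\<lambda>j. 1 / L\<^sup>2 * \<bar>t j\<bar>) summable_on UNIV"
      using t[THEN summable_on_iff_abs_summable_on_real[THEN iffD1]]
      by (intro summable_on_cmult_right) simp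
    show "\<bar>(w n j - h n j) * t j\<bar> \<le> 1 / L\<^sup>2 * \<bar>t j\<bar>" for n j
    proof -
      have "\<bar>w n j - h n j\<bar> \<le> 1 / L\<^sup>2"
        using PP[of "m n j" "m n (- j)"] L(1) unfolding w_def h by (auto simp: abs_le_iff)
      then show ?thesis
        unfolding abs_mult by (rule mult_right_mono) simp
    qed
    show "(\<lambda>n. (w n j - h n j) * t j) \<longlonglongrightarrow> 0" for j
    proof (rule tendsto_mult_left_zero, rule Lim_null_comparison)
      show "\<forall>\<^sub>F n in sequentially. norm (w n j - h n j) \<le> \<bar>1 / (P (m n j) * P (m n (- j))) - 1 / (L * L)\<bar>"
        using eventually_ge_at_top[of "nat \<bar>j\<bar>"]
        by eventually_elim (auto simp: w_def h power2_eq_square)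
      have "(\<lambda>n. 1 / (P (m n j) * P (m n (- j))) - 1 / (L * L)) \<longlonglongrightarrow> 1 / (L * L) - 1 / (L * L)"
        using L(1) by (intro tendsto_intros filterlim_compose[OF L(2) m_lim]) auto
      then show "(\<lambda>n. \<bar>1 / (P (m n j) * P (m n (- j))) - 1 / (L * L)\<bar>) \<longlonglongrightarrow> 0"
        by (simp add: tendsto_rabs_zero)
    qed
  qed
  moreover have "(\<Sum>\<^sub>\<infinity>j. (w n j - h n j) * t j) = (\<Sum>\<^sub>\<infinity>j. w n j * t j) - (\<Sum>\<^sub>\<infinity>j. h n j * t j)" for n
    using infsum_add[OF w_summable[of n] summable_on_uminus[THEN iffD2, OF h_summable[of n]]]
    by (simp add: infsum_uminus left_diff_distrib)
  ultimately show ?thesis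
    by (simp add: w_sum h_sum P_def)
qed

text \<open>For \<open>\<alpha> = 1 / 2\<close> and \<open>x = y\<close> the series is a square and has no sign changes on the real line,
  so this case is not covered by \<open>infinite_negative_zeros\<close>.\<close>

lemma stieltjes_wigert_zeros_half:
  fixes x y :: real
  assumes q: "0 < q" "q < 1" and x: "0 < x" "x < 1" and y: "0 < y" "y < 1"
  shows "infinite {t. t < 0 \<and>
    (\<Sum>n. stieltjes_wigert n x y q / qpoch q q n * q powr (1 / 2 * (real n)\<^sup>2) * t ^ n) = 0}"
proof -
  define r where "r = q powr (1 / 2)"
  have r: "0 < r" "r < 1"
    using q powr_less_mono'[of q 0 "1 / 2"] by (auto simp: r_def)
  obtain L where L: "L > 0" "\<And>k. L \<le> qpoch q q k"
    using qpoch_self_limit[OF q] by blast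
  have sm: "summable (\<lambda>n. norm (z ^ n / qpoch q q n * r powr (real n)\<^sup>2 * t ^ n))" if "0 < z" "z < 1" for z t
  proof (rule summable_gaussian_bound[OF r])
    fix n
    have "\<bar>z ^ n / qpoch q q n\<bar> \<le> 1 / L"
      using L(1) L(2)[of n] qpoch_self_pos[OF q, of n] that by (auto intro!: frac_le simp: power_le_one)
    also have "\<dots> \<le> 1 / L * real (Suc n)"
      using L(1) by (simp add: field_simps)
    finally show "\<bar>z ^ n / qpoch q q n * r powr (real n)\<^sup>2\<bar> \<le> 1 / L * real (Suc n) * r powr (real n)\<^sup>2"
      unfolding abs_mult[of _ "r powr _"] abs_of_nonneg[OF powr_ge_zero] by (rule mult_right_mono) simp
  qed
  \<comment> \<open>At \<alpha> = 1/2 the exponent decouples, \<open>n\<^sup>2 / 2 - k * (n - k) =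
    k\<^sup>2 / 2 + (n - k)\<^sup>2 / 2\<close>, so the coefficients form a Cauchy product; zeros of
    one factor then suffice.\<close>
  have coeff: "stieltjes_wigert n x y q / qpoch q q n * q powr (1 / 2 * (real n)\<^sup>2) * t ^ n =
    (\<Sum>k\<le>n. (x ^ k / qpoch q q k * r powr (real k)\<^sup>2 * t ^ k) *
      (y ^ (n - k) / qpoch q q (n - k) * r powr (real (n - k))\<^sup>2 * t ^ (n - k)))" for n t
    unfolding stieltjes_wigert_coeff[OF q] sum_distrib_right
  proof (rule sum.cong)
    fix k assume "k \<in> {..n}"
    then have k: "k \<le> n" by simp
    then have "1 / 2 * (real n)\<^sup>2 - real k * real (n - k) = 1 / 2 * (real k)\<^sup>2 + 1 / 2 * (real (n - k))\<^sup>2"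
      by (simp add: of_nat_diff power2_eq_square field_simps)
    then have "q powr (1 / 2 * (real n)\<^sup>2 - real k * real (n - k)) = r powr (real k)\<^sup>2 * r powr (real (n - k))\<^sup>2"
      by (simp only: powr_add r_def powr_powr)
    moreover have "t ^ n = t ^ k * t ^ (n - k)"
      using k by (simp flip: power_add)
    ultimately show "q powr (1 / 2 * (real n)\<^sup>2 - real k * real (n - k)) *
        (x ^ k / qpoch q q k * (y ^ (n - k) / qpoch q q (n - k))) * t ^ n =
      (x ^ k / qpoch q q k * r powr (real k)\<^sup>2 * t ^ k) *
      (y ^ (n - k) / qpoch q q (n - k) * r powr (real (n - k))\<^sup>2 * t ^ (n - k))"
      by (simp only: mult_ac)
  qed simp
  have "(\<Sum>n. stieltjes_wigert n x y q / qpoch q q n * q powr (1 / 2 * (real n)\<^sup>2) * t ^ n) =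
    (\<Sum>k. x ^ k / qpoch q q k * r powr (real k)\<^sup>2 * t ^ k) * (\<Sum>k. y ^ k / qpoch q q k * r powr (real k)\<^sup>2 * t ^ k)" for t
    unfolding coeff by (rule Cauchy_product[symmetric]; rule sm; fact)
  then have "{t. t < 0 \<and> (\<Sum>k. x ^ k / qpoch q q k * r powr (real k)\<^sup>2 * t ^ k) = 0} \<subseteq> {t. t < 0 \<and>
      (\<Sum>n. stieltjes_wigert n x y q / qpoch q q n * q powr (1 / 2 * (real n)\<^sup>2) * t ^ n) = 0}"
    by auto
  moreover have "infinite {t. t < 0 \<and> (\<Sum>k. x ^ k / qpoch q q k * r powr (real k)\<^sup>2 * t ^ k) = 0}"
    using power_over_qpoch_ratio[OF q, of x] x qpoch_self_pos[OF q]
    by (intro infinite_negative_zeros_ratio[OF r]) auto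
  ultimately show ?thesis
    using finite_subset by blast
qed

text \<open>Split \<open>\<alpha> * n\<^sup>2 - k * (n - k) = (\<alpha> - 1/4) * n\<^sup>2 + (2 * k
  - n)\<^sup>2 / 4\<close> and \<open>x ^ k * y ^ (n - k) = \<rho> ^ n * u powi (2 * k - n)\<close>.
  What depends on \<open>k\<close> is then the sum in \<open>theta_parity_limit\<close>, and
  \<alpha> > 1/2 says \<open>p < s\<close>, as \<open>theta_compare\<close> requires.\<close>

lemma stieltjes_wigert_zeros_gt_half:
  fixes x y :: real
  assumes q: "0 < q" "q < 1" and \<alpha>: "\<alpha> > 1 / 2" and x: "0 < x" and y: "0 < y"
  shows "infinite {t. t < 0 \<and>
    (\<Sum>n. stieltjes_wigert n x y q / qpoch q q n * q powr (\<alpha> * (real n)\<^sup>2) * t ^ n) = 0}"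
proof -
  define s where "s = q powr (1 / 4)"
  define p where "p = q powr (\<alpha> - 1 / 4)"
  have s: "0 < s" "s < 1"
    using q powr_less_mono'[of q 0 "1 / 4"] by (auto simp: s_def)
  have p: "0 < p" "p < s"
    using q \<alpha> powr_less_mono'[of q "1 / 4" "\<alpha> - 1 / 4"] by (auto simp: p_def s_def)
  have p1: "p < 1"
    using p s by simp
  define u where "u = sqrt (x / y)"
  define \<rho> where "\<rho> = sqrt (x * y)"
  have u: "u > 0" and \<rho>: "\<rho> > 0"
    using x y by (auto simp: u_def \<rho>_def)
  have xy: "x = \<rho> * u" "y = \<rho> / u"
    using x y by (simp_all add: u_def \<rho>_def flip: real_sqrt_mult real_sqrt_divide)
  obtain L where L: "L > 0" "qpoch q q \<longlonglongrightarrow> L" "\<And>k. L \<le> qpoch q q k"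
    using qpoch_self_limit[OF q] by blast
  define e where "e n = (\<Sum>k\<le>n. s powr (real_of_int (2 * int k - int n))\<^sup>2 * u powi (2 * int k - int n) /
      (qpoch q q k * qpoch q q (n - k)))" for n
  define A where "A = theta s u / (2 * L\<^sup>2)"
  define B where "B = theta s (- u) / (2 * L\<^sup>2)"
  have coeff: "stieltjes_wigert n x y q / qpoch q q n * q powr (\<alpha> * (real n)\<^sup>2) = e n * p powr (real n)\<^sup>2 * \<rho> ^ n" for n
    unfolding stieltjes_wigert_coeff[OF q] e_def sum_distrib_right
  proof (rule sum.cong)
    fix k assume "k \<in> {..n}"
    then have k: "k \<le> n" by simp
    then have "\<alpha> * (real n)\<^sup>2 - real k * real (n - k) =
        (\<alpha> - 1 / 4) * (real n)\<^sup>2 + 1 / 4 * (real_of_int (2 * int k - int n))\<^sup>2"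
      by (simp add: of_nat_diff power2_eq_square algebra_simps)
    then have "q powr (\<alpha> * (real n)\<^sup>2 - real k * real (n - k)) =
        p powr (real n)\<^sup>2 * s powr (real_of_int (2 * int k - int n))\<^sup>2"
      by (simp only: powr_add p_def s_def powr_powr)
    moreover have "x ^ k * y ^ (n - k) = \<rho> ^ n * u powi (2 * int k - int n)"
    proof -
      have "2 * int k - int n = int k - int (n - k)"
        using k by simp
      then have "u powi (2 * int k - int n) = u ^ k / u ^ (n - k)"
        using u power_int_diff[of u "int k" "int (n - k)"] by (simp only: power_int_of_nat) simp
      moreover have "\<rho> ^ n = \<rho> ^ k * \<rho> ^ (n - k)"
        using k by (simp flip: power_add)
      ultimately show ?thesis
        by (simp add: xy power_mult_distrib power_divide)
    qed
    ultimately show "q powr (\<alpha> * (real n)\<^sup>2 - real k * real (n - k)) *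
        (x ^ k / qpoch q q k * (y ^ (n - k) / qpoch q q (n - k))) =
      s powr (real_of_int (2 * int k - int n))\<^sup>2 * u powi (2 * int k - int n) /
        (qpoch q q k * qpoch q q (n - k)) * p powr (real n)\<^sup>2 * \<rho> ^ n"
      by (simp add: mult_ac)
  qed simp
  have lim: "(\<lambda>n. e n - (A + (- 1) ^ n * B)) \<longlonglongrightarrow> 0"
    unfolding e_def A_def B_def by (rule theta_parity_limit[OF s q L])
  then have "Bseq (\<lambda>n. e n - (A + (- 1) ^ n * B))"
    by (intro convergent_imp_Bseq convergentI)
  then obtain K where K: "\<And>n. \<bar>e n - (A + (- 1) ^ n * B)\<bar> \<le> K"
    unfolding Bseq_def by auto
  have bound: "\<bar>e n\<bar> \<le> K + \<bar>A\<bar> + \<bar>B\<bar>" for n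
  proof -
    have "\<bar>(- 1) ^ n * B\<bar> = \<bar>B\<bar>"
      by (simp add: abs_mult)
    then show ?thesis
      using K[of n] by linarith
  qed
  have "infinite {t. t < 0 \<and> (\<Sum>n. e n * p powr (real n)\<^sup>2 * t ^ n) = 0}"
  \<comment> \<open>\<open>e\<close> approaches a sequence of period 2 and is bounded, so neither
    growth nor normalisation is needed: \<open>D = 1\<close> and \<open>b\<close> constant.\<close>
  proof (rule infinite_negative_zeros[where b = "\<lambda>_. 1" and D = 1 and C = "K + \<bar>A\<bar> + \<bar>B\<bar>" and A = A and B = B])
    show "(\<lambda>m. e (nat (int m + k)) / 1 - (A + (- 1) ^ nat (int m + k) * B)) \<longlonglongrightarrow> 0" for k
      using filterlim_compose[OF lim filterlim_nat_int_add[of k]] by simp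
    show "\<bar>B\<bar> * theta p 1 < A * theta p (- 1)"
      using divide_strict_right_mono[OF theta_compare[OF p s(2) u], of "2 * L\<^sup>2"] L(1)
      by (simp add: A_def B_def)
  qed (use bound p p1 in auto)
  from infinite_negative_zeros_scale[OF this \<rho>] show ?thesis
    unfolding coeff .
qed

lemma stieltjes_wigert_series_zeros:
  assumes q: "0 < q" "q < 1" and \<alpha>: "\<alpha> \<ge> 1 / 2" and x: "- 1 < x" "x < 0" and y: "- 1 < y" "y < 0"
  shows "infinite {z \<in> \<real>. stieltjes_wigert_series \<alpha> x y q z = 0}"
    and "\<And>z. z \<in> \<real> \<Longrightarrow> stieltjes_wigert_series \<alpha> x y q z = 0 \<Longrightarrow> Re z > 0"
proof -
  define c where "c n = stieltjes_wigert n (- x) (- y) q / qpoch q q n * q powr (\<alpha> * (real n)\<^sup>2)" for n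
  define F where "F z = (\<Sum>n. complex_of_real (c n) * z ^ n)" for z
  have eq: "stieltjes_wigert_series \<alpha> x y q z = F (- z)" for z
  proof -
    have "stieltjes_wigert n x y q = (- 1) ^ n * stieltjes_wigert n (- x) (- y) q" for n
      using stieltjes_wigert_minus[of n "- x" "- y" q] by simp
    then have "complex_of_real (stieltjes_wigert n x y q / qpoch q q n * q powr (\<alpha> * (real n)\<^sup>2)) * z ^ n =
        complex_of_real (c n) * (- z) ^ n" for n
      unfolding c_def power_minus[of z n] by simp
    then show ?thesis
      by (simp add: stieltjes_wigert_series_def F_def)
  qed
  have inf: "infinite {t. t < 0 \<and> (\<Sum>n. c n * t ^ n) = 0}"
  proof (cases "\<alpha> = 1 / 2")
    case True
    show ?thesis
      unfolding c_def True by (rule stieltjes_wigert_zeros_half[OF q]) (use x y in auto)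
  next
    case False
    with \<alpha> show ?thesis
      unfolding c_def by (intro stieltjes_wigert_zeros_gt_half[OF q]) (use x y in auto)
  qed
  have pos: "c n > 0" for n
    unfolding c_def stieltjes_wigert_coeff[OF q]
    using x y q by (intro sum_pos mult_pos_pos divide_pos_pos qpoch_self_pos zero_less_power) auto
  define p where "p = q powr (\<alpha> - 1 / 4)"
  have p: "0 < p" "p < 1"
    using q \<alpha> powr_less_mono'[of q 0 "\<alpha> - 1 / 4"] by (auto simp: p_def)
  obtain L where L: "L > 0" "\<And>k. L \<le> qpoch q q k"
    using qpoch_self_limit[OF q] by blast
  have "c n \<le> 1 / L\<^sup>2 * real (Suc n) * p powr (real n)\<^sup>2" for n
    unfolding c_def stieltjes_wigert_coeff[OF q]
  proof (rule sum_over_qpoch_bound[OF q L])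
    fix k assume k: "k \<le> n"
    \<comment> \<open>This is \<open>k * (n - k) \<le> n\<^sup>2 / 4\<close>, the source of the
      Gaussian base \<open>q powr (\<alpha> - 1/4)\<close>.\<close>
    have "0 \<le> (real n - 2 * real k)\<^sup>2"
      by simp
    then have "(\<alpha> - 1 / 4) * (real n)\<^sup>2 \<le> \<alpha> * (real n)\<^sup>2 - real k * real (n - k)"
      using k by (simp add: of_nat_diff power2_eq_square algebra_simps)
    then show "q powr (\<alpha> * (real n)\<^sup>2 - real k * real (n - k)) \<le> p powr (real n)\<^sup>2"
      using q by (simp add: p_def powr_powr powr_mono')
  qed (use x y in auto)
  then have "\<bar>c n\<bar> \<le> 1 / L\<^sup>2 * real (Suc n) * p powr (real n)\<^sup>2" for n
    using pos[of n] by simp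
  then have sm: "summable (\<lambda>n. c n * t ^ n)" for t
    by (intro summable_norm_cancel[OF summable_gaussian_bound[OF p]])
  note zeros = complex_series_zeros[OF pos sm inf, folded F_def]
  have "infinite (uminus ` {z \<in> \<real>. F z = 0})"
    using zeros(1) by (subst finite_image_iff) auto
  moreover have "uminus ` {z \<in> \<real>. F z = 0} \<subseteq> {z \<in> \<real>. stieltjes_wigert_series \<alpha> x y q z = 0}"
    by (auto simp: eq)
  ultimately show "infinite {z \<in> \<real>. stieltjes_wigert_series \<alpha> x y q z = 0}"
    using finite_subset by blast
  show "Re z > 0" if "z \<in> \<real>" "stieltjes_wigert_series \<alpha> x y q z = 0" for z
    using zeros(2)[of "- z"] that by (simp add: eq)
qed

theorem theorem1p2:
  fixes q :: real
  assumes "0 < q" and "q < 1"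
  shows "(\<forall>\<alpha> x y :: real. \<alpha> > 0 \<longrightarrow> 0 < x \<longrightarrow> x < 1 \<longrightarrow> 0 < y \<longrightarrow> y < 1 \<longrightarrow>
            infinite {z \<in> \<real>. rogers_szego_series \<alpha> x y q z = 0} \<and>
            (\<forall>z \<in> \<real>. rogers_szego_series \<alpha> x y q z = 0 \<longrightarrow> Re z < 0)) \<and>
         (\<forall>\<alpha> x y :: real. \<alpha> \<ge> 1 / 2 \<longrightarrow> - 1 < x \<longrightarrow> x < 0 \<longrightarrow> - 1 < y \<longrightarrow> y < 0 \<longrightarrow>
            infinite {z \<in> \<real>. stieltjes_wigert_series \<alpha> x y q z = 0} \<and>
            (\<forall>z \<in> \<real>. stieltjes_wigert_series \<alpha> x y q z = 0 \<longrightarrow> Re z > 0))"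
  by (intro conjI allI impI ballI;
      rule rogers_szego_series_zeros[OF assms] stieltjes_wigert_series_zeros[OF assms]; assumption)

end
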